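(* Let $D$ be a finite distributive lattice that is isomorphic to the congruence lattice of a slim rectangular lattice, and let $n:=|\mathrm{J}(D)|$. Then there exists a slim rectangular lattice $L$ such that $\mathrm{Con}\,L\cong D$, $\mathrm{length}(L)\leq 3n^2$, and $|L|\leq 9n^4$.
   Context: For a finite lattice $L$, $\mathrm{J}(L)$ is the set of (nonzero) join-irreducible elements and $\mathrm{M}(L)$ is the set of (non-unit) meet-irreducible elements. A slim semimodular lattice (SPS lattice) is a finite planar semimodular lattice having no sublattice isomorphic to $M_3$; equivalently, a finite semimodular lattice $L$ such that $\mathrm{J}(L)$ is the union of two chains. A slim semimodular lattice $L$ is a slim rectangular lattice if $\mathrm{J}(L)\cap\mathrm{M}(L)$ has exactly two elements, and these two elements are complementary. $\mathrm{Con}\,L$ is the congruence lattice of $L$, and $\mathrm{length}(L)$ is the length of $L$, that is, one less than the number of elements of a maximum-sized chain in $L$. *)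

theory Defs
  imports "HOL-Algebra.Lattice"
begin

definition finite_lattice :: "'a gorder \<Rightarrow> bool" where
  "finite_lattice L \<longleftrightarrow> lattice L \<and> finite (carrier L)"

definition distributive_lattice :: "'a gorder \<Rightarrow> bool" where
  "distributive_lattice L \<longleftrightarrow> lattice L \<and>
    (\<forall>x \<in> carrier L. \<forall>y \<in> carrier L. \<forall>z \<in> carrier L.
      x \<sqinter>\<^bsub>L\<^esub> (y \<squnion>\<^bsub>L\<^esub> z) = (x \<sqinter>\<^bsub>L\<^esub> y) \<squnion>\<^bsub>L\<^esub> (x \<sqinter>\<^bsub>L\<^esub> z))"

definition covers :: "'a gorder \<Rightarrow> 'a \<Rightarrow> 'a \<Rightarrow> bool" where
  "covers L x y \<longleftrightarrow> x \<in> carrier L \<and> y \<in> carrier L \<and> x \<sqsubset>\<^bsub>L\<^esub> y \<and>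
    \<not> (\<exists>z \<in> carrier L. x \<sqsubset>\<^bsub>L\<^esub> z \<and> z \<sqsubset>\<^bsub>L\<^esub> y)"

definition semimodular_lattice :: "'a gorder \<Rightarrow> bool" where
  "semimodular_lattice L \<longleftrightarrow> lattice L \<and>
    (\<forall>x \<in> carrier L. \<forall>y \<in> carrier L. \<forall>z \<in> carrier L.
      covers L x y \<longrightarrow>
        x \<squnion>\<^bsub>L\<^esub> z = y \<squnion>\<^bsub>L\<^esub> z \<or> covers L (x \<squnion>\<^bsub>L\<^esub> z) (y \<squnion>\<^bsub>L\<^esub> z))"

definition join_irreducibles :: "'a gorder \<Rightarrow> 'a set" where
  "join_irreducibles L = {j \<in> carrier L. j \<noteq> \<bottom>\<^bsub>L\<^esub> \<and>
    (\<forall>x \<in> carrier L. \<forall>y \<in> carrier L. j = x \<squnion>\<^bsub>L\<^esub> y \<longrightarrow> j = x \<or> j = y)}"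

definition meet_irreducibles :: "'a gorder \<Rightarrow> 'a set" where
  "meet_irreducibles L = {m \<in> carrier L. m \<noteq> \<top>\<^bsub>L\<^esub> \<and>
    (\<forall>x \<in> carrier L. \<forall>y \<in> carrier L. m = x \<sqinter>\<^bsub>L\<^esub> y \<longrightarrow> m = x \<or> m = y)}"

definition chain_in :: "'a gorder \<Rightarrow> 'a set \<Rightarrow> bool" where
  "chain_in L C \<longleftrightarrow> C \<subseteq> carrier L \<and> (\<forall>x \<in> C. \<forall>y \<in> C. x \<sqsubseteq>\<^bsub>L\<^esub> y \<or> y \<sqsubseteq>\<^bsub>L\<^esub> x)"

text \<open>Only meant for finite nonempty lattices.\<close>

definition lattice_length :: "'a gorder \<Rightarrow> nat" where
  "lattice_length L = Max (card ` {C. chain_in L C}) - 1"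

text \<open>Of the two usual definitions of slim semimodular lattices (planar semimodular without a
  sublattice \<open>M\<^sub>3\<close>; semimodular with the join-irreducibles forming a union of two
  chains), this is the one that does not refer to planar diagrams.\<close>

definition slim_semimodular :: "'a gorder \<Rightarrow> bool" where
  "slim_semimodular L \<longleftrightarrow> finite_lattice L \<and> semimodular_lattice L \<and>
    (\<exists>C1 C2. chain_in L C1 \<and> chain_in L C2 \<and> join_irreducibles L = C1 \<union> C2)"

definition complementary :: "'a gorder \<Rightarrow> 'a \<Rightarrow> 'a \<Rightarrow> bool" where
  "complementary L u v \<longleftrightarrow> u \<sqinter>\<^bsub>L\<^esub> v = \<bottom>\<^bsub>L\<^esub> \<and> u \<squnion>\<^bsub>L\<^esub> v = \<top>\<^bsub>L\<^esub>"

definition slim_rectangular :: "'a gorder \<Rightarrow> bool" where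
  "slim_rectangular L \<longleftrightarrow> slim_semimodular L \<and>
    (\<exists>u v. u \<noteq> v \<and> join_irreducibles L \<inter> meet_irreducibles L = {u, v} \<and>
      complementary L u v)"

definition lattice_congruence :: "'a gorder \<Rightarrow> ('a \<times> 'a) set \<Rightarrow> bool" where
  "lattice_congruence L \<theta> \<longleftrightarrow> equiv (carrier L) \<theta> \<and>
    (\<forall>(x, x') \<in> \<theta>. \<forall>(y, y') \<in> \<theta>.
      (x \<squnion>\<^bsub>L\<^esub> y, x' \<squnion>\<^bsub>L\<^esub> y') \<in> \<theta> \<and> (x \<sqinter>\<^bsub>L\<^esub> y, x' \<sqinter>\<^bsub>L\<^esub> y') \<in> \<theta>)"

definition Con :: "'a gorder \<Rightarrow> ('a \<times> 'a) set gorder" where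
  "Con L = \<lparr>carrier = {\<theta>. lattice_congruence L \<theta>}, eq = (=), le = (\<subseteq>)\<rparr>"

definition lattice_isomorphic :: "'a gorder \<Rightarrow> 'b gorder \<Rightarrow> bool" where
  "lattice_isomorphic A B \<longleftrightarrow>
    (\<exists>f. bij_betw f (carrier A) (carrier B) \<and> join_pres A B f \<and> meet_pres A B f)"

end

theory Submission
  imports Defs
begin

text \<open>The proof places a slim semimodular lattice in the plane. Choose two maximal chains that together
contain the join-irreducible elements and give each meet-irreducible element, as its two
coordinates, its heights relative to these chains. Semimodularity makes both coordinates injective,
and an element \<open>a\<close> of the lattice corresponds to the set of meet-irreducibles above
\<open>a\<close>, which is a quadrant, that is, the set of points to the right of one line and above
another. So a slim semimodular lattice is the lattice of quadrants of a finite point set, ordered by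
reverse inclusion (\<open>quadrant_lattice_of_chains\<close>), and conversely every finite point set
with injective coordinates yields such a lattice (\<open>slim\<close>). Joins are intersections, and
a covering pair differs in exactly one point.

A congruence collapses, together with one covering pair that differs in the point \<open>e\<close>, all
covering pairs that differ in \<open>e\<close>; so it is determined by the set of points it collapses.
Which sets of points occur is governed by a relation of the points: \<open>f\<close> lights \<open>e\<close>
if \<open>e\<close> lies below \<open>f\<close>, to the right of \<open>f\<close>, but to the left of every
point strictly above \<open>f\<close>, and some point lies to the right of and below \<open>e\<close>; or if
the same holds with the two coordinates exchanged. The congruence lattice is isomorphic to the lattice
of point sets that contain every point lit by one of their members (\<open>Con_order_iso\<close>).
In particular, principal closed sets are join-irreducible, so that the number \<open>k\<close> of classes of
points with the same principal closed set is at most \<open>n\<close>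
(\<open>card_principal_le_join_irreducibles\<close>).

Most points are redundant. If \<open>f\<close> lights \<open>e\<close>, then all points strictly above
\<open>f\<close> are strictly above \<open>e\<close>. Hence the points of one class have the same points
strictly above them, which implies that they light each other directly. The strips lit by the members
of a class are thus bounded on the far side by the same two points, the leftmost and the lowest point
strictly above. It therefore suffices to keep these two points for every class, and for every ordered
pair of classes two members that witness the lighting between these classes if there is any: at most
\<open>2k\<^sup>2 + 2k \<le> 3k\<^sup>2\<close> points, with \<open>k \<ge> 2\<close>. The remaining points light
each other as before, and so the congruence lattice does not change (\<open>small_point_set\<close>).

A slim semimodular lattice is rectangular if and only if its point set has two extreme corner points
(\<open>corners_if_rectangular\<close>, \<open>rectangular_if_corners\<close>). Each corner point is alone
in its class, so it is kept, and its properties pass to subsets that contain it. Finally, the length is at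
most the number of points. A nonempty quadrant is given by its leftmost and its lowest point, and the
empty quadrant by the two corners, so that \<open>N\<close> points with corners have at most
\<open>N\<^sup>2\<close> quadrants.\<close>

section \<open>Order isomorphisms\<close>

definition order_iso :: "'a gorder \<Rightarrow> 'b gorder \<Rightarrow> ('a \<Rightarrow> 'b) \<Rightarrow> bool" where
  "order_iso A B f \<longleftrightarrow> bij_betw f (carrier A) (carrier B) \<and>
    (\<forall>a \<in> carrier A. \<forall>b \<in> carrier A. a \<sqsubseteq>\<^bsub>A\<^esub> b \<longleftrightarrow> f a \<sqsubseteq>\<^bsub>B\<^esub> f b)"

definition inclusion_order :: "'a set set \<Rightarrow> 'a set gorder" where
  "inclusion_order F = \<lparr>carrier = F, eq = (=), le = (\<subseteq>)\<rparr>"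

lemma inclusion_order_simps [simp]:
  "carrier (inclusion_order F) = F"
  "a \<sqsubseteq>\<^bsub>inclusion_order F\<^esub> b \<longleftrightarrow> a \<subseteq> b"
  by (simp_all add: inclusion_order_def)

lemma Con_eq: "Con L = inclusion_order {\<theta>. lattice_congruence L \<theta>}"
  by (simp add: Con_def inclusion_order_def)

lemma order_iso_trans:
  assumes "order_iso A B f" and "order_iso B C g"
  shows "order_iso A C (g \<circ> f)"
  using assms bij_betw_trans[of f "carrier A" "carrier B" g "carrier C"]
  unfolding order_iso_def by (auto simp: bij_betw_apply)

lemma order_iso_sym:
  assumes "order_iso A B f"
  shows "order_iso B A (inv_into (carrier A) f)"
proof -
  have b: "bij_betw f (carrier A) (carrier B)" using assms by (simp add: order_iso_def)
  show ?thesis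
    unfolding order_iso_def
  proof (intro conjI ballI)
    show "bij_betw (inv_into (carrier A) f) (carrier B) (carrier A)"
      by (rule bij_betw_inv_into[OF b])
    fix c d assume "c \<in> carrier B" "d \<in> carrier B"
    then obtain a a' where "a \<in> carrier A" "c = f a" "a' \<in> carrier A" "d = f a'"
      using b unfolding bij_betw_def by blast
    then show "c \<sqsubseteq>\<^bsub>B\<^esub> d \<longleftrightarrow> inv_into (carrier A) f c \<sqsubseteq>\<^bsub>A\<^esub> inv_into (carrier A) f d"
      using assms b by (simp add: order_iso_def bij_betw_inv_into_left)
  qed
qed

lemma least_Upper_pair_iff:
  "least L s (Upper L {a, b}) \<longleftrightarrow> s \<in> carrier L \<and>
    (a \<in> carrier L \<longrightarrow> a \<sqsubseteq>\<^bsub>L\<^esub> s) \<and> (b \<in> carrier L \<longrightarrow> b \<sqsubseteq>\<^bsub>L\<^esub> s) \<and>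
    (\<forall>u \<in> carrier L. (a \<in> carrier L \<longrightarrow> a \<sqsubseteq>\<^bsub>L\<^esub> u) \<and> (b \<in> carrier L \<longrightarrow> b \<sqsubseteq>\<^bsub>L\<^esub> u) \<longrightarrow> s \<sqsubseteq>\<^bsub>L\<^esub> u)"
  unfolding least_def Upper_def by blast

lemma greatest_Lower_pair_iff:
  "greatest L s (Lower L {a, b}) \<longleftrightarrow> s \<in> carrier L \<and>
    (a \<in> carrier L \<longrightarrow> s \<sqsubseteq>\<^bsub>L\<^esub> a) \<and> (b \<in> carrier L \<longrightarrow> s \<sqsubseteq>\<^bsub>L\<^esub> b) \<and>
    (\<forall>u \<in> carrier L. (a \<in> carrier L \<longrightarrow> u \<sqsubseteq>\<^bsub>L\<^esub> a) \<and> (b \<in> carrier L \<longrightarrow> u \<sqsubseteq>\<^bsub>L\<^esub> b) \<longrightarrow> u \<sqsubseteq>\<^bsub>L\<^esub> s)"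
  unfolding greatest_def Lower_def by blast

lemma latticeI:
  fixes L :: "'a gorder"
  assumes eq: "eq L = (=)"
    and refl: "\<And>a. a \<in> carrier L \<Longrightarrow> a \<sqsubseteq>\<^bsub>L\<^esub> a"
    and antisym: "\<And>a b. \<lbrakk>a \<in> carrier L; b \<in> carrier L; a \<sqsubseteq>\<^bsub>L\<^esub> b; b \<sqsubseteq>\<^bsub>L\<^esub> a\<rbrakk> \<Longrightarrow> a = b"
    and trans: "\<And>a b c. \<lbrakk>a \<in> carrier L; b \<in> carrier L; c \<in> carrier L; a \<sqsubseteq>\<^bsub>L\<^esub> b; b \<sqsubseteq>\<^bsub>L\<^esub> c\<rbrakk> \<Longrightarrow> a \<sqsubseteq>\<^bsub>L\<^esub> c"
    and join: "\<And>a b. \<lbrakk>a \<in> carrier L; b \<in> carrier L\<rbrakk> \<Longrightarrow> \<exists>s. least L s (Upper L {a, b})"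
    and meet: "\<And>a b. \<lbrakk>a \<in> carrier L; b \<in> carrier L\<rbrakk> \<Longrightarrow> \<exists>s. greatest L s (Lower L {a, b})"
  shows "lattice L"
proof -
  interpret partial_order L
  proof unfold_locales
    show "x \<sqsubseteq>\<^bsub>L\<^esub> z" if "x \<sqsubseteq>\<^bsub>L\<^esub> y" "y \<sqsubseteq>\<^bsub>L\<^esub> z" "x \<in> carrier L" "y \<in> carrier L" "z \<in> carrier L"
      for x y z using trans that by blast
  qed (simp_all add: eq refl antisym)
  show ?thesis
    by unfold_locales (fact join, fact meet)
qed

text \<open>An order isomorphism onto a lattice transports the lattice structure, because joins and
  meets are determined by the order.\<close>

lemma lattice_isomorphic_if_order_iso:
  fixes A :: "'a gorder" and B :: "'b gorder"
  assumes iso: "order_iso A B f" and eqA: "eq A = (=)" and B: "lattice B"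
  shows "lattice_isomorphic A B"
proof -
  interpret B: lattice B by fact
  let ?g = "inv_into (carrier A) f"
  have b: "bij_betw f (carrier A) (carrier B)" using iso by (simp add: order_iso_def)
  have le: "a \<sqsubseteq>\<^bsub>A\<^esub> a' \<longleftrightarrow> f a \<sqsubseteq>\<^bsub>B\<^esub> f a'" if "a \<in> carrier A" "a' \<in> carrier A" for a a'
    using iso that by (simp add: order_iso_def)
  have fc: "f a \<in> carrier B" if "a \<in> carrier A" for a using b that by (rule bij_betw_apply)
  have gc: "?g c \<in> carrier A" if "c \<in> carrier B" for c
    using bij_betw_apply[OF bij_betw_inv_into[OF b] that] .
  have fg: "f (?g c) = c" if "c \<in> carrier B" for c using b that by (rule bij_betw_inv_into_right)
  have inj: "a = a'" if "a \<in> carrier A" "a' \<in> carrier A" "f a = f a'" for a a'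
    using b that by (auto simp: bij_betw_def inj_on_def)
  have join: "least A (?g (f a \<squnion>\<^bsub>B\<^esub> f a')) (Upper A {a, a'})"
    if "a \<in> carrier A" "a' \<in> carrier A" for a a'
    using that unfolding least_Upper_pair_iff
    by (auto simp: le fc gc fg B.join_left B.join_right intro!: B.join_le)
  have meet: "greatest A (?g (f a \<sqinter>\<^bsub>B\<^esub> f a')) (Lower A {a, a'})"
    if "a \<in> carrier A" "a' \<in> carrier A" for a a'
    using that unfolding greatest_Lower_pair_iff
    by (auto simp: le fc gc fg B.meet_left B.meet_right intro!: B.meet_le)
  have A: "lattice A"
  proof (rule latticeI[OF eqA])
    show "a \<sqsubseteq>\<^bsub>A\<^esub> a" if "a \<in> carrier A" for a
      using that by (simp add: le fc)
    show "a = a'" if "a \<in> carrier A" "a' \<in> carrier A" "a \<sqsubseteq>\<^bsub>A\<^esub> a'" "a' \<sqsubseteq>\<^bsub>A\<^esub> a" for a a'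
      using that by (intro inj B.le_antisym) (simp_all add: le fc)
    show "a \<sqsubseteq>\<^bsub>A\<^esub> c"
      if "a \<in> carrier A" "b \<in> carrier A" "c \<in> carrier A" "a \<sqsubseteq>\<^bsub>A\<^esub> b" "b \<sqsubseteq>\<^bsub>A\<^esub> c" for a b c
      using that B.le_trans[of "f a" "f b" "f c"] by (simp add: le fc)
  qed (blast intro: join meet)+
  interpret A: lattice A by fact
  have "f (a \<squnion>\<^bsub>A\<^esub> a') = f a \<squnion>\<^bsub>B\<^esub> f a'" if "a \<in> carrier A" "a' \<in> carrier A" for a a'
  proof -
    have "least A (a \<squnion>\<^bsub>A\<^esub> a') (Upper A {a, a'})"
      using A.sup_of_two_least[OF that] by (simp add: join_def)
    then have "a \<squnion>\<^bsub>A\<^esub> a' = ?g (f a \<squnion>\<^bsub>B\<^esub> f a')" using join[OF that] A.least_unique by blast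
    then show ?thesis using that by (simp add: fg fc)
  qed
  moreover have "f (a \<sqinter>\<^bsub>A\<^esub> a') = f a \<sqinter>\<^bsub>B\<^esub> f a'" if "a \<in> carrier A" "a' \<in> carrier A" for a a'
  proof -
    have "greatest A (a \<sqinter>\<^bsub>A\<^esub> a') (Lower A {a, a'})"
      using A.inf_of_two_greatest[OF that] by (simp add: meet_def)
    then have "a \<sqinter>\<^bsub>A\<^esub> a' = ?g (f a \<sqinter>\<^bsub>B\<^esub> f a')" using meet[OF that] A.greatest_unique by blast
    then show ?thesis using that by (simp add: fg fc)
  qed
  ultimately show ?thesis
    unfolding lattice_isomorphic_def join_pres_def meet_pres_def using A B b by blast
qed

lemma order_iso_if_lattice_isomorphic:
  fixes A :: "'a gorder" and B :: "'b gorder"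
  assumes "lattice_isomorphic A B"
  obtains f where "order_iso A B f"
proof -
  obtain f where b: "bij_betw f (carrier A) (carrier B)" and pres: "join_pres A B f"
    using assms by (auto simp: lattice_isomorphic_def)
  have A: "lattice A" and B: "lattice B"
    using pres by (auto simp: join_pres_def)
  have j: "f (a \<squnion>\<^bsub>A\<^esub> a') = f a \<squnion>\<^bsub>B\<^esub> f a'" if "a \<in> carrier A" "a' \<in> carrier A" for a a'
    using pres that by (auto simp: join_pres_def)
  interpret A: lattice A by fact
  interpret B: lattice B by fact
  have "a \<sqsubseteq>\<^bsub>A\<^esub> a' \<longleftrightarrow> f a \<sqsubseteq>\<^bsub>B\<^esub> f a'" if a: "a \<in> carrier A" "a' \<in> carrier A" for a a'
  proof -
    have "f a \<in> carrier B" "f a' \<in> carrier B" using b a by (auto intro: bij_betw_apply)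
    then have "f a \<sqsubseteq>\<^bsub>B\<^esub> f a' \<longleftrightarrow> f (a \<squnion>\<^bsub>A\<^esub> a') = f a'"
      by (simp add: j a B.le_iff_meet)
    also have "\<dots> \<longleftrightarrow> a \<squnion>\<^bsub>A\<^esub> a' = a'"
      using b a by (auto simp: bij_betw_def inj_on_def)
    finally show ?thesis using a by (simp add: A.le_iff_meet)
  qed
  then have "order_iso A B f" using b by (simp add: order_iso_def)
  then show ?thesis by (rule that)
qed

text \<open>If the least member \<open>P p\<close> that contains \<open>p\<close> is a join, it is contained in the union
of the two joinands, which is again a member; so the joinand that contains \<open>p\<close> contains all of it.\<close>

lemma card_principal_le_join_irreducibles:
  fixes D :: "'d gorder" and F :: "'p set set"
  assumes D: "finite_lattice D" and g: "order_iso D (inclusion_order F) g"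
    and empty: "{} \<in> F" and un: "\<And>S T. \<lbrakk>S \<in> F; T \<in> F\<rbrakk> \<Longrightarrow> S \<union> T \<in> F"
    and P: "\<And>p. p \<in> E \<Longrightarrow> P p \<in> F \<and> p \<in> P p \<and> (\<forall>T \<in> F. p \<in> T \<longrightarrow> P p \<subseteq> T)"
  shows "card (P ` E) \<le> card (join_irreducibles D)"
proof -
  interpret D: lattice D using D by (simp add: finite_lattice_def)
  have b: "bij_betw g (carrier D) F" using g by (simp add: order_iso_def)
  have le: "a \<sqsubseteq>\<^bsub>D\<^esub> a' \<longleftrightarrow> g a \<subseteq> g a'" if "a \<in> carrier D" "a' \<in> carrier D" for a a'
    using g that by (simp add: order_iso_def)
  let ?h = "inv_into (carrier D) g"
  have hc: "?h S \<in> carrier D" and gh: "g (?h S) = S" if "S \<in> F" for S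
    using that b by (auto simp: bij_betw_def inv_into_into f_inv_into_f)
  have gF: "g a \<in> F" if "a \<in> carrier D" for a using b that by (auto intro: bij_betw_apply)
  have "weak_partial_order_bottom D"
  proof unfold_locales
    have "least D (?h {}) (carrier D)"
      by (simp add: least_def hc gh empty le)
    then show "\<exists>s. least D s (carrier D)" ..
  qed
  then interpret D: weak_partial_order_bottom D .
  have gbot: "g \<bottom>\<^bsub>D\<^esub> = {}"
    using le[of "\<bottom>\<^bsub>D\<^esub>" "?h {}"] by (simp add: hc gh empty)
  have irr: "?h (P p) \<in> join_irreducibles D" if p: "p \<in> E" for p
    unfolding join_irreducibles_def
  proof (intro CollectI conjI ballI impI)
    have PF: "P p \<in> F" and pP: "p \<in> P p" and min: "\<And>T. \<lbrakk>T \<in> F; p \<in> T\<rbrakk> \<Longrightarrow> P p \<subseteq> T"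
      using P[OF p] by auto
    show "?h (P p) \<in> carrier D" using PF by (rule hc)
    show "?h (P p) \<noteq> \<bottom>\<^bsub>D\<^esub>" using gbot gh[OF PF] pP by auto
    fix a a' assume a: "a \<in> carrier D" "a' \<in> carrier D" and eq: "?h (P p) = a \<squnion>\<^bsub>D\<^esub> a'"
    have un': "g a \<union> g a' \<in> F" using a gF un by blast
    have "?h (P p) \<sqsubseteq>\<^bsub>D\<^esub> ?h (g a \<union> g a')"
      unfolding eq using a un' by (intro D.join_le) (auto simp: le hc gh)
    then have "P p \<subseteq> g a \<union> g a'" using PF un' by (simp add: le hc gh)
    then have "P p \<subseteq> g a \<or> P p \<subseteq> g a'" using pP min a gF by blast
    then have "?h (P p) \<sqsubseteq>\<^bsub>D\<^esub> a \<or> ?h (P p) \<sqsubseteq>\<^bsub>D\<^esub> a'" using a PF by (simp add: le hc gh)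
    moreover have "a \<sqsubseteq>\<^bsub>D\<^esub> ?h (P p)" "a' \<sqsubseteq>\<^bsub>D\<^esub> ?h (P p)"
      unfolding eq using a by (auto intro: D.join_left D.join_right)
    ultimately show "?h (P p) = a \<or> ?h (P p) = a'"
      using a hc[OF PF] D.le_antisym by blast
  qed
  have "inj_on ?h (P ` E)"
    using gh P by (intro inj_on_inverseI[where g = g]) blast
  moreover have "finite (join_irreducibles D)"
    using D by (auto simp: join_irreducibles_def finite_lattice_def)
  ultimately show ?thesis using irr
    by (intro card_inj_on_le[where f = ?h]) auto
qed

section \<open>Lattices of quadrants of a planar point set\<close>

lemma obtain_arg_max:
  fixes z :: "'b \<Rightarrow> nat"
  assumes "finite S" and "S \<noteq> {}"
  obtains f where "f \<in> S" and "\<And>g. g \<in> S \<Longrightarrow> z g \<le> z f"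
proof -
  have "Max (z ` S) \<in> z ` S" using assms by (intro Max_in) auto
  then obtain f where "f \<in> S" "z f = Max (z ` S)" by auto
  then show ?thesis using that[of f] assms by simp
qed

lemma obtain_arg_min:
  fixes z :: "'b \<Rightarrow> nat"
  assumes "S \<noteq> {}"
  obtains f where "f \<in> S" and "\<And>g. g \<in> S \<Longrightarrow> z f \<le> z g"
  using assms ex_has_least_nat[of "\<lambda>f. f \<in> S" _ z] by blast

text \<open>A set of the form \<open>{e \<in> E. i \<le> x e \<and> j \<le> y e}\<close>, described without
mentioning the bounds \<open>i\<close> and \<open>j\<close>; they are not determined by the set. The
description makes intersections and hulls immediate; \<open>quadrant_corner\<close> recovers bounds.\<close>

definition quadrants :: "'p set \<Rightarrow> ('p \<Rightarrow> nat) \<Rightarrow> ('p \<Rightarrow> nat) \<Rightarrow> 'p set set" where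
  "quadrants E x y = {A. A \<subseteq> E \<and> (\<forall>p \<in> A. \<forall>q \<in> A. \<forall>e \<in> E. x p \<le> x e \<and> y q \<le> y e \<longrightarrow> e \<in> A)}"

definition hull :: "'p set \<Rightarrow> ('p \<Rightarrow> nat) \<Rightarrow> ('p \<Rightarrow> nat) \<Rightarrow> 'p set \<Rightarrow> 'p set" where
  "hull E x y S = {e \<in> E. (\<exists>p \<in> S. x p \<le> x e) \<and> (\<exists>q \<in> S. y q \<le> y e)}"

definition weakly_above :: "'p set \<Rightarrow> ('p \<Rightarrow> nat) \<Rightarrow> ('p \<Rightarrow> nat) \<Rightarrow> 'p \<Rightarrow> 'p set" where
  "weakly_above E x y p = {e \<in> E. x p \<le> x e \<and> y p \<le> y e}"

definition strictly_above :: "'p set \<Rightarrow> ('p \<Rightarrow> nat) \<Rightarrow> ('p \<Rightarrow> nat) \<Rightarrow> 'p \<Rightarrow> 'p set" where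
  "strictly_above E x y p = {e \<in> E. x p < x e \<and> y p < y e}"

lemma quadrants_swap: "quadrants E y x = quadrants E x y"
  unfolding quadrants_def by blast

lemma weakly_above_swap: "weakly_above E y x p = weakly_above E x y p"
  unfolding weakly_above_def by blast

lemma strictly_above_swap: "strictly_above E y x p = strictly_above E x y p"
  unfolding strictly_above_def by blast

lemma quadrants_subset: "A \<in> quadrants E x y \<Longrightarrow> A \<subseteq> E"
  by (simp add: quadrants_def)

lemma quadrantsD:
  "\<lbrakk>A \<in> quadrants E x y; p \<in> A; q \<in> A; e \<in> E; x p \<le> x e; y q \<le> y e\<rbrakk> \<Longrightarrow> e \<in> A"
  unfolding quadrants_def by blast

lemma hull_quadrant: "hull E x y S \<in> quadrants E x y"
  unfolding quadrants_def hull_def by (auto intro: order_trans)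

lemma subset_hull: "S \<subseteq> E \<Longrightarrow> S \<subseteq> hull E x y S"
  unfolding hull_def by auto

lemma hull_minimal: "\<lbrakk>S \<subseteq> A; A \<in> quadrants E x y\<rbrakk> \<Longrightarrow> hull E x y S \<subseteq> A"
  unfolding hull_def by (auto dest: quadrantsD)

lemma hull_absorb: "\<lbrakk>S \<subseteq> A; A \<in> quadrants E x y\<rbrakk> \<Longrightarrow> hull E x y (A \<union> S) = A"
  using hull_minimal[of "A \<union> S" A E x y] subset_hull[of A E x y] quadrants_subset[of A E x y]
  by (simp add: Un_absorb2 subset_antisym)

lemma empty_quadrant: "{} \<in> quadrants E x y" and full_quadrant: "E \<in> quadrants E x y"
  by (auto simp: quadrants_def)

lemma inter_quadrant:
  "\<lbrakk>A \<in> quadrants E x y; B \<in> quadrants E x y\<rbrakk> \<Longrightarrow> A \<inter> B \<in> quadrants E x y"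
  unfolding quadrants_def by blast

lemma right_quadrant: "{e \<in> E. i \<le> x e} \<in> quadrants E x y"
  and upper_quadrant: "{e \<in> E. i \<le> y e} \<in> quadrants E x y"
  and strict_right_quadrant: "{e \<in> E. i < x e} \<in> quadrants E x y"
  by (auto simp: quadrants_def)

lemma weakly_above_quadrant: "weakly_above E x y p \<in> quadrants E x y"
  by (auto simp: quadrants_def weakly_above_def)

lemma strictly_above_quadrant: "strictly_above E x y p \<in> quadrants E x y"
  by (auto simp: quadrants_def strictly_above_def)

lemma quadrant_corner:
  assumes "finite E" and A: "A \<in> quadrants E x y" and "A \<noteq> {}"
  obtains p q where "p \<in> A" and "q \<in> A" and "\<forall>e \<in> A. x p \<le> x e" and "\<forall>e \<in> A. y q \<le> y e"
    and "A = {e \<in> E. x p \<le> x e \<and> y q \<le> y e}"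
proof -
  have fin: "finite A" using assms quadrants_subset finite_subset by metis
  define p where "p = arg_min_on x A"
  define q where "q = arg_min_on y A"
  have p: "p \<in> A" "\<forall>e \<in> A. x p \<le> x e"
    unfolding p_def using arg_min_if_finite(1)[OF fin \<open>A \<noteq> {}\<close>] arg_min_least[OF fin \<open>A \<noteq> {}\<close>] by auto
  have q: "q \<in> A" "\<forall>e \<in> A. y q \<le> y e"
    unfolding q_def using arg_min_if_finite(1)[OF fin \<open>A \<noteq> {}\<close>] arg_min_least[OF fin \<open>A \<noteq> {}\<close>] by auto
  have "A = {e \<in> E. x p \<le> x e \<and> y q \<le> y e}"
    using p q quadrants_subset[OF A] quadrantsD[OF A] by blast
  then show ?thesis using that p q by blast
qed

locale planar_points =
  fixes E :: "'p set" and x y :: "'p \<Rightarrow> nat"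
  assumes finite_E: "finite E" and inj_x: "inj_on x E" and inj_y: "inj_on y E"
begin

lemma planar_points_swap: "planar_points E y x"
  using finite_E inj_x inj_y by unfold_locales

lemma planar_points_subset: "S \<subseteq> E \<Longrightarrow> planar_points S x y"
  using finite_E inj_x inj_y by unfold_locales (auto intro: finite_subset inj_on_subset)

lemma x_eqD: "\<lbrakk>p \<in> E; q \<in> E; x p = x q\<rbrakk> \<Longrightarrow> p = q"
  using inj_x by (auto dest: inj_onD)

lemma y_eqD: "\<lbrakk>p \<in> E; q \<in> E; y p = y q\<rbrakk> \<Longrightarrow> p = q"
  using inj_y by (auto dest: inj_onD)

lemma weakly_above_minus: "p \<in> E \<Longrightarrow> weakly_above E x y p - {p} = strictly_above E x y p"
  using x_eqD y_eqD unfolding weakly_above_def strictly_above_def by (auto simp: less_le)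

lemma in_weakly_above: "p \<in> E \<Longrightarrow> p \<in> weakly_above E x y p"
  by (simp add: weakly_above_def)

lemma not_in_strictly_above: "p \<notin> strictly_above E x y p"
  by (simp add: strictly_above_def)

text \<open>Taking away the leftmost or the lowest point of the larger quadrant leaves a quadrant, and a
smaller quadrant cannot contain both of these points.\<close>

lemma quadrant_remove_point:
  assumes A: "A \<in> quadrants E x y" and B: "B \<in> quadrants E x y" and "B \<subset> A"
  obtains e where "e \<in> A" and "e \<notin> B" and "A - {e} \<in> quadrants E x y"
proof -
  have AE: "A \<subseteq> E" and BE: "B \<subseteq> E" by (rule quadrants_subset[OF A], rule quadrants_subset[OF B])
  have "A \<noteq> {}" using \<open>B \<subset> A\<close> by blast
  obtain p q where p: "p \<in> A" and q: "q \<in> A" and px: "\<forall>e \<in> A. x p \<le> x e"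
    and qy: "\<forall>e \<in> A. y q \<le> y e" and "A = {e \<in> E. x p \<le> x e \<and> y q \<le> y e}"
    by (rule quadrant_corner[OF finite_E A \<open>A \<noteq> {}\<close>])
  have "A - {p} \<in> quadrants E x y"
    unfolding quadrants_def
  proof (intro CollectI conjI ballI impI)
    fix r s e assume r: "r \<in> A - {p}" "s \<in> A - {p}" "e \<in> E" "x r \<le> x e \<and> y s \<le> y e"
    then have "e \<in> A" using quadrantsD[OF A] by blast
    moreover have "x p < x r" using p px r AE x_eqD[of p r] by (auto simp: less_le)
    ultimately show "e \<in> A - {p}" using r by auto
  qed (use AE in auto)
  moreover have "A - {q} \<in> quadrants E x y"
    unfolding quadrants_def
  proof (intro CollectI conjI ballI impI)
    fix r s e assume r: "r \<in> A - {q}" "s \<in> A - {q}" "e \<in> E" "x r \<le> x e \<and> y s \<le> y e"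
    then have "e \<in> A" using quadrantsD[OF A] by blast
    moreover have "y q < y s" using q qy r AE y_eqD[of q s] by (auto simp: less_le)
    ultimately show "e \<in> A - {q}" using r by auto
  qed (use AE in auto)
  moreover have "p \<notin> B \<or> q \<notin> B"
  proof (rule ccontr)
    assume "\<not> (p \<notin> B \<or> q \<notin> B)"
    then have "A \<subseteq> B" using quadrantsD[OF B, of p q] px qy AE by auto
    then show False using \<open>B \<subset> A\<close> by simp
  qed
  ultimately show ?thesis using that p q by blast
qed

end

locale quadrant_lattice = planar_points E x y
  for E :: "'p set" and x y :: "'p \<Rightarrow> nat" +
  fixes L :: "'a gorder" and cl :: "'a \<Rightarrow> 'p set"
  assumes eq_L: "eq L = (=)"
    and cl_bij: "bij_betw cl (carrier L) (quadrants E x y)"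
    and le_iff: "\<lbrakk>a \<in> carrier L; b \<in> carrier L\<rbrakk> \<Longrightarrow> a \<sqsubseteq>\<^bsub>L\<^esub> b \<longleftrightarrow> cl b \<subseteq> cl a"
begin

lemma quadrant_lattice_swap: "quadrant_lattice E y x L cl"
  using planar_points_swap eq_L cl_bij le_iff
  by (simp add: quadrant_lattice_def quadrant_lattice_axioms_def quadrants_swap[of E x y])

definition el :: "'p set \<Rightarrow> 'a" where
  "el = inv_into (carrier L) cl"

lemma cl_quadrant: "a \<in> carrier L \<Longrightarrow> cl a \<in> quadrants E x y"
  using cl_bij by (rule bij_betw_apply)

lemma cl_subset: "a \<in> carrier L \<Longrightarrow> cl a \<subseteq> E"
  using cl_quadrant quadrants_subset by blast

lemma el_closed: "A \<in> quadrants E x y \<Longrightarrow> el A \<in> carrier L"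
  unfolding el_def using bij_betw_apply[OF bij_betw_inv_into[OF cl_bij]] .

lemma cl_el: "A \<in> quadrants E x y \<Longrightarrow> cl (el A) = A"
  unfolding el_def using cl_bij by (rule bij_betw_inv_into_right)

lemma cl_inj: "\<lbrakk>a \<in> carrier L; b \<in> carrier L; cl a = cl b\<rbrakk> \<Longrightarrow> a = b"
  using cl_bij by (auto simp: bij_betw_def inj_on_def)

lemma el_cl: "a \<in> carrier L \<Longrightarrow> el (cl a) = a"
  unfolding el_def using cl_bij by (rule bij_betw_inv_into_left)

lemma lattice_L: "lattice L"
proof (rule latticeI[OF eq_L])
  fix a b assume ab: "a \<in> carrier L" "b \<in> carrier L"
  have I: "cl a \<inter> cl b \<in> quadrants E x y" using ab by (simp add: inter_quadrant cl_quadrant)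
  have H: "hull E x y (cl a \<union> cl b) \<in> quadrants E x y" by (rule hull_quadrant)
  have sub: "cl a \<union> cl b \<subseteq> hull E x y (cl a \<union> cl b)"
    using ab cl_subset by (intro subset_hull) blast
  have "least L (el (cl a \<inter> cl b)) (Upper L {a, b})"
    using ab I by (auto simp: least_Upper_pair_iff el_closed le_iff cl_el)
  then show "\<exists>s. least L s (Upper L {a, b})" ..
  have "greatest L (el (hull E x y (cl a \<union> cl b))) (Lower L {a, b})"
    using ab H sub hull_minimal[of "cl a \<union> cl b" _ E x y]
    by (auto simp: greatest_Lower_pair_iff el_closed le_iff cl_el cl_quadrant)
  then show "\<exists>s. greatest L s (Lower L {a, b})" ..
next
  fix a b assume "a \<in> carrier L" "b \<in> carrier L" "a \<sqsubseteq>\<^bsub>L\<^esub> b" "b \<sqsubseteq>\<^bsub>L\<^esub> a"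
  then show "a = b" by (intro cl_inj) (auto simp: le_iff)
qed (auto simp: le_iff)

sublocale lat: lattice L
  by (rule lattice_L)

lemma cl_join: 
  assumes ab: "a \<in> carrier L" "b \<in> carrier L"
  shows "cl (a \<squnion>\<^bsub>L\<^esub> b) = cl a \<inter> cl b"
proof -
  have I: "cl a \<inter> cl b \<in> quadrants E x y" using ab by (simp add: inter_quadrant cl_quadrant)
  have "least L (el (cl a \<inter> cl b)) (Upper L {a, b})"
    using ab I by (auto simp: least_Upper_pair_iff el_closed le_iff cl_el)
  moreover have "least L (a \<squnion>\<^bsub>L\<^esub> b) (Upper L {a, b})"
    using lat.sup_of_two_least[OF ab] by (simp add: join_def)
  ultimately have "a \<squnion>\<^bsub>L\<^esub> b = el (cl a \<inter> cl b)" using lat.least_unique by blast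
  then show ?thesis using I by (simp add: cl_el)
qed

lemma cl_meet: 
  assumes ab: "a \<in> carrier L" "b \<in> carrier L"
  shows "cl (a \<sqinter>\<^bsub>L\<^esub> b) = hull E x y (cl a \<union> cl b)"
proof -
  have H: "hull E x y (cl a \<union> cl b) \<in> quadrants E x y" by (rule hull_quadrant)
  have sub: "cl a \<union> cl b \<subseteq> hull E x y (cl a \<union> cl b)"
    using ab cl_subset by (intro subset_hull) blast
  have "greatest L (el (hull E x y (cl a \<union> cl b))) (Lower L {a, b})"
    using ab H sub hull_minimal[of "cl a \<union> cl b" _ E x y]
    by (auto simp: greatest_Lower_pair_iff el_closed le_iff cl_el cl_quadrant)
  moreover have "greatest L (a \<sqinter>\<^bsub>L\<^esub> b) (Lower L {a, b})"
    using lat.inf_of_two_greatest[OF ab] by (simp add: meet_def)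
  ultimately have "a \<sqinter>\<^bsub>L\<^esub> b = el (hull E x y (cl a \<union> cl b))" using lat.greatest_unique by blast
  then show ?thesis using H by (simp add: cl_el)
qed

lemma bottom_eq: "\<bottom>\<^bsub>L\<^esub> = el E"
proof -
  have l: "least L (el E) (carrier L)"
    by (auto simp: least_def el_closed full_quadrant le_iff cl_el cl_subset)
  then have "least L \<bottom>\<^bsub>L\<^esub> (carrier L)" unfolding bottom_def by (rule someI)
  then show ?thesis using l lat.least_unique by blast
qed

lemma top_eq: "\<top>\<^bsub>L\<^esub> = el {}"
proof -
  have l: "greatest L (el {}) (carrier L)"
    by (auto simp: greatest_def el_closed empty_quadrant le_iff cl_el)
  then have "greatest L \<top>\<^bsub>L\<^esub> (carrier L)" unfolding top_def by (rule someI)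
  then show ?thesis using l lat.greatest_unique by blast
qed

lemma cl_bottom: "cl \<bottom>\<^bsub>L\<^esub> = E" and cl_top: "cl \<top>\<^bsub>L\<^esub> = {}"
  by (simp_all add: bottom_eq top_eq cl_el full_quadrant empty_quadrant)

lemma less_iff: "\<lbrakk>a \<in> carrier L; b \<in> carrier L\<rbrakk> \<Longrightarrow> a \<sqsubset>\<^bsub>L\<^esub> b \<longleftrightarrow> cl b \<subset> cl a"
  using cl_inj[of a b] by (auto simp: lless_def eq_L le_iff)

lemma finite_L: "finite (carrier L)"
proof -
  have "finite (quadrants E x y)"
    using finite_E by (rule finite_subset[rotated, OF finite_Pow_iff[THEN iffD2]])
      (auto simp: quadrants_def)
  then show ?thesis using cl_bij bij_betw_finite by blast
qed

lemma covers_iff: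
  assumes ab: "a \<in> carrier L" "b \<in> carrier L"
  shows "covers L a b \<longleftrightarrow> (\<exists>e. e \<notin> cl b \<and> cl a = insert e (cl b))"
proof
  assume c: "covers L a b"
  then have "cl b \<subset> cl a" using ab by (simp add: covers_def less_iff)
  then obtain e where e: "e \<in> cl a" "e \<notin> cl b" "cl a - {e} \<in> quadrants E x y"
    using quadrant_remove_point[OF cl_quadrant cl_quadrant] ab by metis
  define z where "z = el (cl a - {e})"
  have z: "z \<in> carrier L" "cl z = cl a - {e}" using e by (simp_all add: z_def el_closed cl_el)
  have "\<not> (a \<sqsubset>\<^bsub>L\<^esub> z \<and> z \<sqsubset>\<^bsub>L\<^esub> b)" using c z(1) unfolding covers_def by blast
  then have "\<not> (cl z \<subset> cl a \<and> cl b \<subset> cl z)" using z(1) ab by (simp add: less_iff)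
  then have "cl b = cl a - {e}" using e z \<open>cl b \<subset> cl a\<close> by blast
  then show "\<exists>e. e \<notin> cl b \<and> cl a = insert e (cl b)" using e by blast
next
  assume "\<exists>e. e \<notin> cl b \<and> cl a = insert e (cl b)"
  then obtain e where e: "e \<notin> cl b" "cl a = insert e (cl b)" by blast
  have "\<not> (a \<sqsubset>\<^bsub>L\<^esub> z \<and> z \<sqsubset>\<^bsub>L\<^esub> b)" if z: "z \<in> carrier L" for z
    unfolding less_iff[OF ab(1) z] less_iff[OF z ab(2)] e(2) by blast
  moreover have "a \<sqsubset>\<^bsub>L\<^esub> b" unfolding less_iff[OF ab] e(2) using e(1) by blast
  ultimately show "covers L a b" using ab by (simp add: covers_def)
qed

text \<open>Joins are intersections, and intersecting two sets that differ in one point leaves a difference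
of at most one point.\<close>

lemma semimodular: "semimodular_lattice L"
  unfolding semimodular_lattice_def
proof (intro conjI ballI impI lattice_L)
  fix a b c assume abc: "a \<in> carrier L" "b \<in> carrier L" "c \<in> carrier L" and "covers L a b"
  then obtain e where e: "e \<notin> cl b" "cl a = insert e (cl b)" by (auto simp: covers_iff)
  show "a \<squnion>\<^bsub>L\<^esub> c = b \<squnion>\<^bsub>L\<^esub> c \<or> covers L (a \<squnion>\<^bsub>L\<^esub> c) (b \<squnion>\<^bsub>L\<^esub> c)"
  proof (cases "e \<in> cl c")
    case True
    then show ?thesis using e abc by (auto simp: covers_iff cl_join)
  next
    case False
    then have "cl (a \<squnion>\<^bsub>L\<^esub> c) = cl (b \<squnion>\<^bsub>L\<^esub> c)" using e abc by (simp add: cl_join)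
    then show ?thesis using abc cl_inj by simp
  qed
qed

text \<open>Each quadrant is the intersection of a vertical and a horizontal half-plane. The half-planes
of either kind form a chain, which makes the lattice slim.\<close>

lemma join_irreducible_half_plane:
  assumes j: "j \<in> join_irreducibles L"
  shows "(\<exists>i. cl j = {e \<in> E. i \<le> x e}) \<or> (\<exists>i. cl j = {e \<in> E. i \<le> y e})"
proof (cases "cl j = {}")
  case True
  obtain i where "\<forall>e \<in> E. x e < i" using finite_E by (meson finite_nat_set_iff_bounded finite_imageI image_eqI)
  then show ?thesis using True by (force simp: not_le)
next
  case False
  have jc: "j \<in> carrier L" using j by (simp add: join_irreducibles_def)
  obtain p q where eq: "cl j = {e \<in> E. x p \<le> x e \<and> y q \<le> y e}"
    by (rule quadrant_corner[OF finite_E cl_quadrant[OF jc] False])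
  let ?a = "el {e \<in> E. x p \<le> x e}" and ?b = "el {e \<in> E. y q \<le> y e}"
  have c: "?a \<in> carrier L" "?b \<in> carrier L" by (simp_all add: el_closed right_quadrant upper_quadrant)
  have "cl j = cl (?a \<squnion>\<^bsub>L\<^esub> ?b)"
    using eq by (auto simp: cl_join[OF c] cl_el right_quadrant upper_quadrant)
  then have "j = ?a \<squnion>\<^bsub>L\<^esub> ?b" using jc c by (intro cl_inj) simp_all
  then have "j = ?a \<or> j = ?b" using j c by (auto simp: join_irreducibles_def)
  then have "cl j = {e \<in> E. x p \<le> x e} \<or> cl j = {e \<in> E. y q \<le> y e}"
    by (metis cl_el right_quadrant upper_quadrant)
  then show ?thesis by blast
qed

lemma slim: "slim_semimodular L"
  unfolding slim_semimodular_def finite_lattice_def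
proof (intro conjI lattice_L finite_L semimodular exI)
  let ?C = "\<lambda>z. {j \<in> join_irreducibles L. \<exists>i. cl j = {e \<in> E. i \<le> (z e :: nat)}}"
  have "chain_in L (?C z)" for z
    unfolding chain_in_def
  proof (intro conjI ballI)
    show "?C z \<subseteq> carrier L" by (auto simp: join_irreducibles_def)
    fix j k assume "j \<in> ?C z" "k \<in> ?C z"
    then obtain m n where "cl j = {e \<in> E. m \<le> z e}" "cl k = {e \<in> E. n \<le> z e}"
      and "j \<in> carrier L" "k \<in> carrier L" by (auto simp: join_irreducibles_def)
    moreover have "m \<le> n \<or> n \<le> m" by linarith
    ultimately show "j \<sqsubseteq>\<^bsub>L\<^esub> k \<or> k \<sqsubseteq>\<^bsub>L\<^esub> j" by (auto simp: le_iff)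
  qed
  then show "chain_in L (?C x)" "chain_in L (?C y)" by blast+
  show "join_irreducibles L = ?C x \<union> ?C y"
    by (auto dest: join_irreducible_half_plane)
qed

lemma length_le: "lattice_length L \<le> card E"
proof -
  have "card C \<le> Suc (card E)" if C: "chain_in L C" for C
  proof -
    have "inj_on (card \<circ> cl) C"
    proof (rule inj_onI)
      fix a b assume ab: "a \<in> C" "b \<in> C" and eq: "(card \<circ> cl) a = (card \<circ> cl) b"
      have c: "a \<in> carrier L" "b \<in> carrier L" using ab C by (auto simp: chain_in_def)
      have "a \<sqsubseteq>\<^bsub>L\<^esub> b \<or> b \<sqsubseteq>\<^bsub>L\<^esub> a" using ab C unfolding chain_in_def by blast
      then have "cl a \<subseteq> cl b \<or> cl b \<subseteq> cl a" using c by (auto simp: le_iff)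
      moreover have "finite (cl a)" "finite (cl b)" using c by (auto intro: finite_subset[OF cl_subset finite_E])
      ultimately have "cl a = cl b" using eq by (auto dest: card_subset_eq)
      then show "a = b" by (rule cl_inj[OF c])
    qed
    moreover have "(card \<circ> cl) ` C \<subseteq> {..card E}"
      using C by (auto simp: chain_in_def intro!: card_mono[OF finite_E] intro: subsetD[OF cl_subset])
    ultimately have "card C \<le> card {..card E}" by (rule card_inj_on_le) simp
    then show ?thesis by simp
  qed
  moreover have "finite {C. chain_in L C}"
    using finite_L by (rule finite_subset[rotated, OF finite_Pow_iff[THEN iffD2]])
      (auto simp: chain_in_def)
  moreover have "{} \<in> {C. chain_in L C}" by (simp add: chain_in_def)
  ultimately have "Max (card ` {C. chain_in L C}) \<le> Suc (card E)"
    by (subst Max_le_iff) auto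
  then show ?thesis unfolding lattice_length_def by linarith
qed

end

section \<open>Congruences as sets of collapsed points\<close>

text \<open>These are the conditions under which collapsing \<open>f\<close> collapses \<open>e\<close>. Let
\<open>C\<close> be the half-plane of the points to the right of \<open>e\<close>. The strip condition
puts all points strictly above \<open>f\<close> into \<open>C\<close>, and thanks to \<open>c\<close>
the hull of \<open>C\<close> and \<open>f\<close> contains \<open>e\<close>.\<close>

definition lit_below :: "'p set \<Rightarrow> ('p \<Rightarrow> nat) \<Rightarrow> ('p \<Rightarrow> nat) \<Rightarrow> 'p \<Rightarrow> 'p \<Rightarrow> bool" where
  "lit_below E x y e f \<longleftrightarrow> e \<in> E \<and> f \<in> E \<and> x f < x e \<and> y e < y f \<and>
    (\<forall>g \<in> strictly_above E x y f. x e < x g) \<and> (\<exists>c \<in> E. x e < x c \<and> y c < y e)"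

definition lit :: "'p set \<Rightarrow> ('p \<Rightarrow> nat) \<Rightarrow> ('p \<Rightarrow> nat) \<Rightarrow> 'p \<Rightarrow> 'p \<Rightarrow> bool" where
  "lit E x y e f \<longleftrightarrow> lit_below E x y e f \<or> lit_below E y x e f"

definition lit_closed :: "'p set \<Rightarrow> ('p \<Rightarrow> nat) \<Rightarrow> ('p \<Rightarrow> nat) \<Rightarrow> 'p set set" where
  "lit_closed E x y = {T. T \<subseteq> E \<and> (\<forall>e f. lit E x y e f \<and> f \<in> T \<longrightarrow> e \<in> T)}"

lemma lit_swap: "lit E y x e f \<longleftrightarrow> lit E x y e f"
  by (auto simp: lit_def)

lemma lit_closed_swap: "lit_closed E y x = lit_closed E x y"
  by (simp add: lit_closed_def lit_swap)

context planar_points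
begin

text \<open>Suppose \<open>e\<close> is in the hull of \<open>A\<close> and \<open>C\<close> with \<open>A\<close>
reaching far enough to the left and \<open>C\<close> far enough down. Among the points of
\<open>A\<close> to the left of \<open>e\<close>, the rightmost one lights \<open>e\<close>, since all
points strictly above it belong to \<open>A\<close>. As \<open>e \<notin> T\<close>, this point is not
in \<open>T\<close> either and survives in \<open>B\<close>.\<close>

lemma hull_covered_by_lit_below:
  assumes T: "T \<in> lit_closed E x y"
    and A: "A \<in> quadrants E x y" and C: "C \<in> quadrants E x y" and BE: "B \<subseteq> E"
    and AB: "A - T \<subseteq> B" and e: "e \<in> E" "e \<notin> T"
    and p: "p \<in> A" "x p \<le> x e" and q: "q \<in> C" "y q \<le> y e" and nA: "e \<notin> A" and nC: "e \<notin> C"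
  shows "\<exists>p \<in> B. x p \<le> x e"
proof -
  have AE: "A \<subseteq> E" and CE: "C \<subseteq> E" by (rule quadrants_subset[OF A], rule quadrants_subset[OF C])
  let ?P = "{f \<in> A. x f \<le> x e}"
  have fin: "finite ?P" using AE finite_E by (auto intro: finite_subset)
  have "?P \<noteq> {}" using p by blast
  then obtain f where f: "f \<in> ?P" and max: "\<And>g. g \<in> ?P \<Longrightarrow> x g \<le> x f"
    using obtain_arg_max[OF fin, of x] by metis
  have fE: "f \<in> E" and fA: "f \<in> A" using f AE by auto
  have "x f \<noteq> x e" using f nA x_eqD[of f e] fE e by auto
  moreover have "\<not> y f \<le> y e"
    using quadrantsD[OF A fA fA e(1)] f nA by blast
  moreover from this have "y e < y f" by simp
  moreover have "x e < x g" if g: "g \<in> strictly_above E x y f" for g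
  proof -
    have "g \<in> E" "x f < x g" "y f < y g" using g by (auto simp: strictly_above_def)
    moreover have "g \<in> A" using calculation quadrantsD[OF A fA fA] by simp
    ultimately show ?thesis using max[of g] by force
  qed
  moreover have "\<not> x q \<le> x e" using quadrantsD[OF C q(1) q(1) e(1)] q nC by blast
  moreover have "y q \<noteq> y e" using q nC y_eqD[of q e] CE e(1) by blast
  ultimately have "lit_below E x y e f"
    using f fE e(1) q CE by (auto simp: lit_below_def not_le intro!: bexI[of _ q])
  then have "f \<notin> T" using T e(2) by (auto simp: lit_closed_def lit_def)
  then show ?thesis using f AB by blast
qed

lemma hull_agree_off_lit_closed:
  assumes T: "T \<in> lit_closed E x y"
    and A: "A \<in> quadrants E x y" and B: "B \<in> quadrants E x y" and C: "C \<in> quadrants E x y"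
    and AB: "A - T \<subseteq> B"
  shows "hull E x y (A \<union> C) - T \<subseteq> hull E x y (B \<union> C)"
proof
  fix e assume e': "e \<in> hull E x y (A \<union> C) - T"
  then have e: "e \<in> E" "e \<notin> T" by (auto simp: hull_def)
  obtain p q where p: "p \<in> A \<union> C" "x p \<le> x e" and q: "q \<in> A \<union> C" "y q \<le> y e"
    using e' by (auto simp: hull_def)
  have BC: "B \<union> C \<subseteq> E" using quadrants_subset[OF B] quadrants_subset[OF C] by simp
  have BE: "B \<subseteq> E" using BC by simp
  interpret sw: planar_points E y x by (rule planar_points_swap)
  consider (B) "e \<in> B" | (C) "e \<in> C" | (AC) "e \<notin> A" "e \<notin> C" using AB e(2) by blast
  then show "e \<in> hull E x y (B \<union> C)"
  proof cases
    case B then show ?thesis using subset_hull[OF BC] by blast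
  next
    case C then show ?thesis using subset_hull[OF BC] by blast
  next
    case AC
    consider "p \<in> A" "q \<in> C" | "p \<in> C" "q \<in> A"
      using p q AC quadrantsD[OF A, of p q] quadrantsD[OF C, of p q] e(1) by blast
    then show ?thesis
    proof cases
      case 1
      then show ?thesis
        using hull_covered_by_lit_below[OF T A C BE AB e 1(1) p(2) 1(2) q(2) AC] q(2) e(1)
        by (auto simp: hull_def)
    next
      case 2
      have "\<exists>p \<in> B. y p \<le> y e"
        by (rule sw.hull_covered_by_lit_below[of T A C B e q p])
          (use T A C BE AB e p q 2 AC in \<open>simp_all add: lit_closed_swap[of E x y] quadrants_swap[of E x y]\<close>)
      then show ?thesis using 2 p(2) e(1) by (auto simp: hull_def)
    qed
  qed
qed

end

lemma lattice_congruenceD: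
  assumes "lattice_congruence L \<theta>"
  shows "(a, b) \<in> \<theta> \<Longrightarrow> a \<in> carrier L \<and> b \<in> carrier L"
    and "a \<in> carrier L \<Longrightarrow> (a, a) \<in> \<theta>"
    and "(a, b) \<in> \<theta> \<Longrightarrow> (b, a) \<in> \<theta>"
    and "\<lbrakk>(a, b) \<in> \<theta>; (b, c) \<in> \<theta>\<rbrakk> \<Longrightarrow> (a, c) \<in> \<theta>"
    and "\<lbrakk>(a, b) \<in> \<theta>; (c, d) \<in> \<theta>\<rbrakk> \<Longrightarrow> (a \<squnion>\<^bsub>L\<^esub> c, b \<squnion>\<^bsub>L\<^esub> d) \<in> \<theta>"
    and "\<lbrakk>(a, b) \<in> \<theta>; (c, d) \<in> \<theta>\<rbrakk> \<Longrightarrow> (a \<sqinter>\<^bsub>L\<^esub> c, b \<sqinter>\<^bsub>L\<^esub> d) \<in> \<theta>"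
  using assms unfolding lattice_congruence_def equiv_def refl_on_def
  by (auto dest: symD transD)

context quadrant_lattice
begin

definition prin :: "'p \<Rightarrow> 'a" where
  "prin p = el (weakly_above E x y p)"

definition punctured :: "'p \<Rightarrow> 'a" where
  "punctured p = el (strictly_above E x y p)"

definition collapsed :: "('a \<times> 'a) set \<Rightarrow> 'p set" where
  "collapsed \<theta> = {e \<in> E. (prin e, punctured e) \<in> \<theta>}"

definition agree_off :: "'p set \<Rightarrow> ('a \<times> 'a) set" where
  "agree_off T = {(a, b). a \<in> carrier L \<and> b \<in> carrier L \<and> cl a - T = cl b - T}"

lemma prin_closed: "prin p \<in> carrier L" and punctured_closed: "punctured p \<in> carrier L"
  and cl_prin: "cl (prin p) = weakly_above E x y p" and cl_punctured: "cl (punctured p) = strictly_above E x y p"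
  by (simp_all add: prin_def punctured_def el_closed cl_el weakly_above_quadrant strictly_above_quadrant)

text \<open>Intersecting with the principal quadrant of a point reduces any congruent pair that differs
  in this point to the pair of that quadrant and its interior.\<close>

lemma collapsedI:
  assumes \<theta>: "lattice_congruence L \<theta>" and ab: "(a, b) \<in> \<theta>" and e: "e \<in> cl a" "e \<notin> cl b"
  shows "e \<in> collapsed \<theta>"
proof -
  note cong = lattice_congruenceD[OF \<theta>]
  have c: "a \<in> carrier L" "b \<in> carrier L" using cong(1)[OF ab] by auto
  have eE: "e \<in> E" using e c cl_subset by blast
  have 1: "prin e \<squnion>\<^bsub>L\<^esub> a = prin e"
    using c e quadrantsD[OF cl_quadrant[OF c(1)] e(1) e(1)]
    by (intro cl_inj) (auto simp: prin_closed cl_prin cl_join weakly_above_def)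
  have sub: "cl (prin e \<squnion>\<^bsub>L\<^esub> b) \<subseteq> strictly_above E x y e"
    using c e eE by (auto simp: prin_closed cl_prin cl_join weakly_above_minus[symmetric])
  have j: "prin e \<squnion>\<^bsub>L\<^esub> b \<in> carrier L" using c prin_closed by simp
  have "cl (punctured e \<sqinter>\<^bsub>L\<^esub> (prin e \<squnion>\<^bsub>L\<^esub> b)) = cl (punctured e)"
    unfolding cl_meet[OF punctured_closed j] cl_punctured
    by (rule hull_absorb[OF sub strictly_above_quadrant])
  then have 2: "punctured e \<sqinter>\<^bsub>L\<^esub> (prin e \<squnion>\<^bsub>L\<^esub> b) = punctured e"
    by (rule cl_inj[OF lat.meet_closed[OF punctured_closed j] punctured_closed])
  have "strictly_above E x y e \<subseteq> weakly_above E x y e" by (auto simp: weakly_above_minus[OF eE, symmetric])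
  then have "cl (punctured e \<sqinter>\<^bsub>L\<^esub> prin e) = cl (prin e)"
    unfolding cl_meet[OF punctured_closed prin_closed] cl_punctured cl_prin
    by (subst Un_commute) (rule hull_absorb[OF _ weakly_above_quadrant])
  then have 3: "punctured e \<sqinter>\<^bsub>L\<^esub> prin e = prin e"
    by (rule cl_inj[OF lat.meet_closed[OF punctured_closed prin_closed] prin_closed])
  have "(prin e \<squnion>\<^bsub>L\<^esub> a, prin e \<squnion>\<^bsub>L\<^esub> b) \<in> \<theta>" by (rule cong(5)[OF cong(2)[OF prin_closed] ab])
  then have "(punctured e \<sqinter>\<^bsub>L\<^esub> prin e, punctured e \<sqinter>\<^bsub>L\<^esub> (prin e \<squnion>\<^bsub>L\<^esub> b)) \<in> \<theta>"
    unfolding 1 by (rule cong(6)[OF cong(2)[OF punctured_closed]])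
  then show ?thesis using eE by (simp add: 2 3 collapsed_def)
qed

lemma agree_off_congruence:
  assumes T: "T \<in> lit_closed E x y"
  shows "lattice_congruence L (agree_off T)"
proof -
  have hull: "hull E x y (A \<union> C) - T \<subseteq> hull E x y (B \<union> D) - T"
    if "A \<in> quadrants E x y" "B \<in> quadrants E x y" "C \<in> quadrants E x y" "D \<in> quadrants E x y"
      "A - T = B - T" "C - T = D - T" for A B C D
  proof -
    have "hull E x y (A \<union> C) - T \<subseteq> hull E x y (B \<union> C) - T"
      using hull_agree_off_lit_closed[OF T that(1,2,3)] that(5) by blast
    also have "\<dots> \<subseteq> hull E x y (B \<union> D) - T"
      using hull_agree_off_lit_closed[OF T that(3,4,2)] that(6) by (simp add: Un_commute) blast
    finally show ?thesis .
  qed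
  show ?thesis
    unfolding lattice_congruence_def
  proof (intro conjI)
    show "equiv (carrier L) (agree_off T)"
      by (rule equivI) (auto simp: agree_off_def refl_on_def intro: symI transI)
    show "\<forall>(a, a') \<in> agree_off T. \<forall>(b, b') \<in> agree_off T.
      (a \<squnion>\<^bsub>L\<^esub> b, a' \<squnion>\<^bsub>L\<^esub> b') \<in> agree_off T \<and> (a \<sqinter>\<^bsub>L\<^esub> b, a' \<sqinter>\<^bsub>L\<^esub> b') \<in> agree_off T"
    proof (clarify, intro conjI)
      fix a a' b b' assume "(a, a') \<in> agree_off T" "(b, b') \<in> agree_off T"
      then have c: "a \<in> carrier L" "a' \<in> carrier L" "b \<in> carrier L" "b' \<in> carrier L"
        and e: "cl a - T = cl a' - T" "cl b - T = cl b' - T" by (auto simp: agree_off_def)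
      show "(a \<squnion>\<^bsub>L\<^esub> b, a' \<squnion>\<^bsub>L\<^esub> b') \<in> agree_off T"
        using c e by (auto simp: agree_off_def cl_join)
      show "(a \<sqinter>\<^bsub>L\<^esub> b, a' \<sqinter>\<^bsub>L\<^esub> b') \<in> agree_off T"
        using c hull[of "cl a" "cl a'" "cl b" "cl b'"] hull[of "cl a'" "cl a" "cl b'" "cl b"] e
        by (simp add: agree_off_def cl_meet cl_quadrant)
    qed
  qed
qed

text \<open>Form the meets of both members of the collapsed pair of \<open>f\<close> with the half-plane to the right of
\<open>e\<close>. The half-plane swallows all points strictly above \<open>f\<close>, whereas its hull with
\<open>f\<close> contains \<open>e\<close>.\<close>

lemma lit_below_collapsed:
  assumes \<theta>: "lattice_congruence L \<theta>" and lit: "lit_below E x y e f" and f: "f \<in> collapsed \<theta>"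
  shows "e \<in> collapsed \<theta>"
proof -
  note cong = lattice_congruenceD[OF \<theta>]
  let ?R = "{p \<in> E. x e < x p}"
  have Rq: "?R \<in> quadrants E x y" by (rule strict_right_quadrant)
  have fE: "f \<in> E" and eE: "e \<in> E" using lit by (auto simp: lit_below_def)
  have "(prin f \<sqinter>\<^bsub>L\<^esub> el ?R, punctured f \<sqinter>\<^bsub>L\<^esub> el ?R) \<in> \<theta>"
    using f cong(6) cong(2)[OF el_closed[OF Rq]] by (simp add: collapsed_def)
  moreover have "e \<in> cl (prin f \<sqinter>\<^bsub>L\<^esub> el ?R)"
    using lit in_weakly_above[OF fE] eE
    by (auto simp: cl_meet prin_closed el_closed Rq cl_prin cl_el hull_def lit_below_def
        intro: bexI[of _ f] less_imp_le)
  moreover have "cl (punctured f \<sqinter>\<^bsub>L\<^esub> el ?R) \<subseteq> ?R"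
  proof -
    have "strictly_above E x y f \<union> ?R \<subseteq> ?R"
      using lit by (auto simp: lit_below_def) (simp add: strictly_above_def)
    then have "hull E x y (strictly_above E x y f \<union> ?R) \<subseteq> ?R" using Rq by (rule hull_minimal)
    then show ?thesis by (simp only: cl_meet punctured_closed el_closed Rq cl_punctured cl_el)
  qed
  ultimately show ?thesis using collapsedI[OF \<theta>] by blast
qed

lemma collapsed_lit_closed:
  assumes \<theta>: "lattice_congruence L \<theta>"
  shows "collapsed \<theta> \<in> lit_closed E x y"
proof -
  interpret sw: quadrant_lattice E y x L cl by (rule quadrant_lattice_swap)
  have "sw.collapsed \<theta> = collapsed \<theta>"
    by (simp add: sw.collapsed_def collapsed_def sw.prin_def prin_def sw.punctured_def punctured_def
        weakly_above_swap[of E y x] strictly_above_swap[of E y x] sw.el_def el_def)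
  then show ?thesis
    using lit_below_collapsed[OF \<theta>] sw.lit_below_collapsed[OF \<theta>]
    by (auto simp: lit_closed_def lit_def) (simp add: collapsed_def)
qed

lemma collapsed_agree_off:
  assumes T: "T \<in> lit_closed E x y"
  shows "collapsed (agree_off T) = T"
proof -
  have "T \<subseteq> E" using T by (simp add: lit_closed_def)
  moreover have "(prin e, punctured e) \<in> agree_off T \<longleftrightarrow> e \<in> T" if "e \<in> E" for e
    using that in_weakly_above[OF that]
    by (auto simp: agree_off_def prin_closed punctured_closed cl_prin cl_punctured weakly_above_minus[symmetric])
  ultimately show ?thesis by (auto simp: collapsed_def)
qed

text \<open>Two comparable quadrants are joined by a chain of single-point removals, and each removal
  of a collapsed point stays within a congruence class.\<close>

lemma remove_collapsed:
  assumes \<theta>: "lattice_congruence L \<theta>" and "a \<in> carrier L" and "b \<in> carrier L"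
    and "cl b \<subseteq> cl a" and "cl a - cl b \<subseteq> collapsed \<theta>"
  shows "(a, b) \<in> \<theta>"
  using assms(2-)
proof (induction "card (cl a - cl b)" arbitrary: a rule: less_induct)
  case less
  note cong = lattice_congruenceD[OF \<theta>]
  show ?case
  proof (cases "cl a = cl b")
    case True
    then show ?thesis using less.prems cl_inj cong(2) by metis
  next
    case False
    then have "cl b \<subset> cl a" using less.prems by blast
    then obtain e where e: "e \<in> cl a" "e \<notin> cl b" "cl a - {e} \<in> quadrants E x y"
      using quadrant_remove_point[OF cl_quadrant cl_quadrant] less.prems by metis
    define z where "z = el (cl a - {e})"
    have z: "z \<in> carrier L" "cl z = cl a - {e}" using e by (simp_all add: z_def el_closed cl_el)
    have eE: "e \<in> E" using e less.prems cl_subset by blast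
    have ab: "weakly_above E x y e \<subseteq> cl a"
      using quadrantsD[OF cl_quadrant[OF less.prems(1)] e(1) e(1)] by (auto simp: weakly_above_def)
    have sab: "strictly_above E x y e \<subseteq> cl z"
      using ab z weakly_above_minus[OF eE] by blast
    have "cl (prin e \<sqinter>\<^bsub>L\<^esub> z) = cl a"
    proof -
      have "weakly_above E x y e \<union> cl z = cl a" using ab z in_weakly_above[OF eE] e by blast
      then show ?thesis
        using hull_minimal[of "cl a" "cl a" E x y] subset_hull[of "cl a" E x y] less.prems cl_subset
        by (simp add: cl_meet prin_closed z(1) cl_prin cl_quadrant subset_antisym)
    qed
    then have 1: "prin e \<sqinter>\<^bsub>L\<^esub> z = a" using less.prems by (intro cl_inj) (simp_all add: prin_closed z(1))
    have "cl (punctured e \<sqinter>\<^bsub>L\<^esub> z) = cl z"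
      using hull_minimal[of "cl z" "cl z" E x y] subset_hull[of "cl z" E x y] cl_subset[OF z(1)] sab
      by (simp add: cl_meet punctured_closed z(1) cl_punctured cl_quadrant subset_antisym Un_absorb1)
    then have 2: "punctured e \<sqinter>\<^bsub>L\<^esub> z = z" by (intro cl_inj) (simp_all add: punctured_closed z(1))
    have "e \<in> collapsed \<theta>" using e less.prems by blast
    then have "(prin e, punctured e) \<in> \<theta>" by (simp add: collapsed_def)
    then have az: "(a, z) \<in> \<theta>" using cong(6)[OF _ cong(2)[OF z(1)]] 1 2 by metis
    have "card (cl z - cl b) < card (cl a - cl b)"
    proof (rule psubset_card_mono)
      show "finite (cl a - cl b)"
        using finite_subset[OF cl_subset[OF less.prems(1)] finite_E] by simp
    qed (use e z in auto)
    then have "(z, b) \<in> \<theta>" using z e less.prems by (intro less.hyps) auto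
    then show ?thesis using az cong(4) by blast
  qed
qed

lemma agree_off_collapsed:
  assumes \<theta>: "lattice_congruence L \<theta>"
  shows "agree_off (collapsed \<theta>) = \<theta>"
proof -
  note cong = lattice_congruenceD[OF \<theta>]
  have "(a, b) \<in> \<theta> \<longleftrightarrow> a \<in> carrier L \<and> b \<in> carrier L \<and> cl a - collapsed \<theta> = cl b - collapsed \<theta>" for a b
  proof
    assume ab: "(a, b) \<in> \<theta>"
    then show "a \<in> carrier L \<and> b \<in> carrier L \<and> cl a - collapsed \<theta> = cl b - collapsed \<theta>"
      using cong(1)[OF ab] collapsedI[OF \<theta> ab] collapsedI[OF \<theta> cong(3)[OF ab]] by blast
  next
    assume *: "a \<in> carrier L \<and> b \<in> carrier L \<and> cl a - collapsed \<theta> = cl b - collapsed \<theta>"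
    then have j: "a \<squnion>\<^bsub>L\<^esub> b \<in> carrier L" "cl (a \<squnion>\<^bsub>L\<^esub> b) = cl a \<inter> cl b" by (auto simp: cl_join)
    have "(a, a \<squnion>\<^bsub>L\<^esub> b) \<in> \<theta>" "(b, a \<squnion>\<^bsub>L\<^esub> b) \<in> \<theta>"
      using * j by (auto intro!: remove_collapsed[OF \<theta>])
    then show "(a, b) \<in> \<theta>" using cong(3,4) by blast
  qed
  then show ?thesis by (auto simp: agree_off_def)
qed

lemma Con_order_iso: "order_iso (Con L) (inclusion_order (lit_closed E x y)) collapsed"
  unfolding order_iso_def Con_eq inclusion_order_simps
proof (intro conjI ballI)
  show "bij_betw collapsed {\<theta>. lattice_congruence L \<theta>} (lit_closed E x y)"
    by (rule bij_betwI[where g = agree_off])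
      (auto simp: collapsed_lit_closed agree_off_congruence collapsed_agree_off agree_off_collapsed)
  fix \<theta> \<psi> assume *: "\<theta> \<in> {\<theta>. lattice_congruence L \<theta>}" "\<psi> \<in> {\<theta>. lattice_congruence L \<theta>}"
  have "agree_off (collapsed \<theta>) \<subseteq> agree_off (collapsed \<psi>)" if "collapsed \<theta> \<subseteq> collapsed \<psi>"
    using that by (auto simp: agree_off_def)
  then show "\<theta> \<subseteq> \<psi> \<longleftrightarrow> collapsed \<theta> \<subseteq> collapsed \<psi>"
    using * by (auto simp: agree_off_collapsed) (auto simp: collapsed_def)
qed

end

section \<open>Rectangularity\<close>

text \<open>Rectangularity expressed by the points: \<open>e\<close> and \<open>f\<close> are the two elements that are
both join- and meet-irreducible. In this form it obviously passes to subsets that contain both points.\<close>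

definition corners :: "'p set \<Rightarrow> ('p \<Rightarrow> nat) \<Rightarrow> ('p \<Rightarrow> nat) \<Rightarrow> 'p \<Rightarrow> 'p \<Rightarrow> bool" where
  "corners E x y e f \<longleftrightarrow> e \<in> E \<and> f \<in> E \<and> (\<forall>p \<in> E. x f \<le> x p) \<and> (\<forall>p \<in> E. y e \<le> y p) \<and>
    (\<forall>p \<in> E. \<not> (x e \<le> x p \<and> y f \<le> y p)) \<and>
    (\<forall>p \<in> E. \<forall>q \<in> E. x e \<le> x p \<and> x p < x q \<longrightarrow> y p < y q) \<and>
    (\<forall>p \<in> E. \<forall>q \<in> E. y f \<le> y p \<and> y p < y q \<longrightarrow> x p < x q)"

lemma corners_swap: "corners E y x f e \<longleftrightarrow> corners E x y e f"
  unfolding corners_def by blast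

lemma corners_subset: "\<lbrakk>corners E x y e f; S \<subseteq> E; e \<in> S; f \<in> S\<rbrakk> \<Longrightarrow> corners S x y e f"
  unfolding corners_def by blast

lemma corners_left_less:
  assumes "corners E x y e f" shows "x f < x e"
proof -
  have "e \<in> E" "f \<in> E" "x f \<le> x e" "y e \<le> y f" "\<not> (x e \<le> x f \<and> y f \<le> y f)"
    using assms by (auto simp: corners_def)
  then show ?thesis by simp
qed

context quadrant_lattice
begin

lemma prin_swap: "quadrant_lattice.prin E y x L cl = prin"
proof -
  interpret sw: quadrant_lattice E y x L cl by (rule quadrant_lattice_swap)
  show ?thesis
    by (simp add: fun_eq_iff sw.prin_def prin_def sw.el_def el_def weakly_above_swap[of E y x])
qed

lemma prin_inj: 
  assumes "p \<in> E" "q \<in> E" "prin p = prin q" shows "p = q"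
proof -
  have "weakly_above E x y p = weakly_above E x y q" using assms(3) cl_prin by metis
  then have "p \<in> weakly_above E x y q" "q \<in> weakly_above E x y p"
    using in_weakly_above[OF assms(1)] in_weakly_above[OF assms(2)] by auto
  then have "x p = x q" by (auto simp: weakly_above_def)
  then show ?thesis using x_eqD assms by blast
qed

lemma weakly_above_subset_cl:
  assumes "a \<in> carrier L" "p \<in> cl a" shows "weakly_above E x y p \<subseteq> cl a"
  using quadrantsD[OF cl_quadrant[OF assms(1)] assms(2) assms(2)] by (auto simp: weakly_above_def)

lemma prin_meet_irreducible:
  assumes p: "p \<in> E" shows "prin p \<in> meet_irreducibles L"
  unfolding meet_irreducibles_def
proof (intro CollectI conjI ballI impI)
  show "prin p \<in> carrier L" by (rule prin_closed)
  show "prin p \<noteq> \<top>\<^bsub>L\<^esub>" using in_weakly_above[OF p] cl_prin[of p] cl_top by auto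
  fix a b assume ab: "a \<in> carrier L" "b \<in> carrier L" and eq: "prin p = a \<sqinter>\<^bsub>L\<^esub> b"
  have h: "weakly_above E x y p = hull E x y (cl a \<union> cl b)"
    using cl_prin[of p] eq cl_meet[OF ab] by simp
  then have sub: "cl a \<union> cl b \<subseteq> weakly_above E x y p"
    using subset_hull[of "cl a \<union> cl b" E x y] cl_subset[OF ab(1)] cl_subset[OF ab(2)] by simp
  have "p \<in> cl a \<union> cl b"
  proof (rule ccontr)
    assume "p \<notin> cl a \<union> cl b"
    then have "cl a \<union> cl b \<subseteq> strictly_above E x y p"
      using sub weakly_above_minus[OF p] by blast
    then have "weakly_above E x y p \<subseteq> strictly_above E x y p"
      unfolding h by (rule hull_minimal[OF _ strictly_above_quadrant])
    then show False using in_weakly_above[OF p] not_in_strictly_above by blast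
  qed
  then have "cl a = weakly_above E x y p \<or> cl b = weakly_above E x y p"
    using sub weakly_above_subset_cl ab by blast
  then show "prin p = a \<or> prin p = b"
    using cl_inj[OF prin_closed] ab cl_prin by metis
qed

lemma meet_irreducible_prin:
  assumes a: "a \<in> meet_irreducibles L"
  obtains p where "p \<in> E" and "a = prin p"
proof -
  have ac: "a \<in> carrier L" using a by (simp add: meet_irreducibles_def)
  have "cl a \<noteq> {}"
  proof
    assume "cl a = {}"
    then have "a = \<top>\<^bsub>L\<^esub>" using ac by (metis el_cl top_eq)
    then show False using a by (simp add: meet_irreducibles_def)
  qed
  obtain p q where pq: "p \<in> cl a" "q \<in> cl a" and "\<forall>e \<in> cl a. x p \<le> x e" "\<forall>e \<in> cl a. y q \<le> y e"
    and eq: "cl a = {e \<in> E. x p \<le> x e \<and> y q \<le> y e}"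
    by (rule quadrant_corner[OF finite_E cl_quadrant[OF ac] \<open>cl a \<noteq> {}\<close>])
  have pqE: "p \<in> E" "q \<in> E" using pq cl_subset[OF ac] by auto
  have "hull E x y (weakly_above E x y p \<union> weakly_above E x y q) = cl a"
  proof
    show "hull E x y (weakly_above E x y p \<union> weakly_above E x y q) \<subseteq> cl a"
      using weakly_above_subset_cl[OF ac] pq by (intro hull_minimal cl_quadrant ac) auto
    show "cl a \<subseteq> hull E x y (weakly_above E x y p \<union> weakly_above E x y q)"
      using in_weakly_above[OF pqE(1)] in_weakly_above[OF pqE(2)] unfolding eq hull_def by blast
  qed
  then have "cl a = cl (prin p \<sqinter>\<^bsub>L\<^esub> prin q)" by (simp add: cl_meet[OF prin_closed prin_closed] cl_prin)
  then have "a = prin p \<sqinter>\<^bsub>L\<^esub> prin q"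
    by (rule cl_inj[OF ac lat.meet_closed[OF prin_closed prin_closed]])
  then have "a = prin p \<or> a = prin q"
    using a prin_closed by (auto simp: meet_irreducibles_def)
  then show ?thesis using that pqE by blast
qed

text \<open>Every quadrant that properly contains the principal quadrant of \<open>h\<close> contains a point to the left
of \<open>h\<close>, hence also the immediate left neighbour \<open>g\<close> of \<open>h\<close>. So the
principal quadrant of \<open>h\<close> is not the intersection of two larger quadrants.\<close>

lemma prin_join_irreducible:
  assumes h: "h \<in> E" and low: "\<And>r. \<lbrakk>r \<in> E; x h \<le> x r\<rbrakk> \<Longrightarrow> y h \<le> y r"
    and g: "g \<in> E" "x g < x h" "y h < y g" and pred: "\<And>r. \<lbrakk>r \<in> E; x r < x h\<rbrakk> \<Longrightarrow> x r \<le> x g"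
  shows "prin h \<in> join_irreducibles L"
  unfolding join_irreducibles_def
proof (intro CollectI conjI ballI impI)
  show "prin h \<in> carrier L" by (rule prin_closed)
  have gW: "g \<notin> weakly_above E x y h" using g by (simp add: weakly_above_def)
  then show "prin h \<noteq> \<bottom>\<^bsub>L\<^esub>" using g(1) cl_prin[of h] cl_bottom by auto
  fix a b assume ab: "a \<in> carrier L" "b \<in> carrier L" and eq: "prin h = a \<squnion>\<^bsub>L\<^esub> b"
  have W: "weakly_above E x y h = cl a \<inter> cl b"
    using cl_prin[of h] eq cl_join[OF ab] by simp
  have hc: "h \<in> cl a" "h \<in> cl b" using W in_weakly_above[OF h] by auto
  have "g \<in> cl c" if c: "c \<in> carrier L" "h \<in> cl c" "cl c \<noteq> weakly_above E x y h" for c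
  proof -
    have "weakly_above E x y h \<subset> cl c" using weakly_above_subset_cl[OF c(1,2)] c(3) by blast
    then obtain p where p: "p \<in> cl c" "p \<notin> weakly_above E x y h" by blast
    have pE: "p \<in> E" using p c cl_subset by blast
    then have "\<not> x h \<le> x p" using p low by (auto simp: weakly_above_def)
    then have "x p \<le> x g" using pred pE by simp
    then show ?thesis using quadrantsD[OF cl_quadrant[OF c(1)] p(1) c(2) g(1)] g(3) by simp
  qed
  then have "cl a = weakly_above E x y h \<or> cl b = weakly_above E x y h"
    using ab hc gW W by blast
  then show "prin h = a \<or> prin h = b"
    using cl_inj[OF prin_closed] ab cl_prin by metis
qed

text \<open>Otherwise take, among the points to the right of \<open>e\<close> that have a higher point between
\<open>e\<close> and themselves, the lowest one. Its minimality puts all points to the right of it above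
it, and its left neighbour above it as well; so it would be a third join-irreducible point.\<close>

lemma chain_right_of_corner:
  assumes e: "e \<in> E" and f: "\<forall>p \<in> E. x f \<le> x p"
    and irr: "\<And>h. \<lbrakk>h \<in> E; prin h \<in> join_irreducibles L\<rbrakk> \<Longrightarrow> h = e \<or> h = f"
    and p: "p \<in> E" and q: "q \<in> E" and ep: "x e \<le> x p" and pq: "x p < x q"
  shows "y p < y q"
proof (rule ccontr)
  define H where "H = {q \<in> E. \<exists>p \<in> E. x e \<le> x p \<and> x p < x q \<and> y q < y p}"
  assume "\<not> y p < y q"
  then have "y q < y p" using y_eqD[OF p q] pq by (cases "y p = y q") auto
  then have "q \<in> H" using p q ep pq by (auto simp: H_def)
  then have "H \<noteq> {}" by blast
  then obtain h where hH: "h \<in> H" and min: "\<And>r. r \<in> H \<Longrightarrow> y h \<le> y r"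
    using obtain_arg_min[of H y] by metis
  then obtain p' where h: "h \<in> E" and p': "p' \<in> E" "x e \<le> x p'" "x p' < x h" "y h < y p'"
    by (auto simp: H_def)
  let ?P = "{r \<in> E. x r < x h}"
  have "finite ?P" "?P \<noteq> {}" using finite_E p' by auto
  then obtain g where g: "g \<in> ?P" and max: "\<And>r. r \<in> ?P \<Longrightarrow> x r \<le> x g"
    using obtain_arg_max[of ?P x] by metis
  have low: "y h \<le> y r" if r: "r \<in> E" "x h \<le> x r" for r
  proof (rule ccontr)
    assume "\<not> y h \<le> y r"
    then have lt: "y r < y h" by simp
    then have "r \<noteq> h" by auto
    then have "x h < x r" using x_eqD[OF h r(1)] r(2) by (auto simp: less_le)
    then have "r \<in> H" using r lt h p' unfolding H_def by (intro CollectI conjI bexI[of _ h]) auto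
    then show False using min lt by fastforce
  qed
  have "y h < y g"
  proof (rule ccontr)
    assume "\<not> y h < y g"
    then have le: "y g \<le> y h" by simp
    have "x p' \<le> x g" using max p' by blast
    moreover have "p' \<noteq> g" using le p' by auto
    ultimately have "x p' < x g" using x_eqD[OF p'(1)] g by (auto simp: less_le)
    then have "g \<in> H" using le p' g unfolding H_def by (intro CollectI conjI bexI[of _ p']) auto
    then have "y h = y g" using min le by fastforce
    then show False using y_eqD[OF h] g by auto
  qed
  then have "prin h \<in> join_irreducibles L"
    using prin_join_irreducible[OF h low, of g] g max by auto
  then have "h = e \<or> h = f" using irr h by blast
  moreover have "x f \<le> x e" using f e by blast
  ultimately show False using p' by auto
qed

lemma corners_if_irreducibles:
  assumes e: "e \<in> E" and f: "f \<in> E" and xf: "\<forall>p \<in> E. x f \<le> x p" and ye: "\<forall>p \<in> E. y e \<le> y p"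
    and irr: "\<And>h. \<lbrakk>h \<in> E; prin h \<in> join_irreducibles L\<rbrakk> \<Longrightarrow> h = e \<or> h = f"
    and disj: "weakly_above E x y e \<inter> weakly_above E x y f = {}"
  shows "corners E x y e f"
proof -
  interpret sw: quadrant_lattice E y x L cl by (rule quadrant_lattice_swap)
  have "\<not> (x e \<le> x p \<and> y f \<le> y p)" if "p \<in> E" for p
    using disj xf ye that by (auto simp: weakly_above_def)
  moreover have "y p < y q" if "p \<in> E" "q \<in> E" "x e \<le> x p" "x p < x q" for p q
    using chain_right_of_corner[OF e xf irr that] by blast
  moreover have "x p < x q" if "p \<in> E" "q \<in> E" "y f \<le> y p" "y p < y q" for p q
    using sw.chain_right_of_corner[OF f ye _ that] irr unfolding prin_swap by blast
  ultimately show ?thesis unfolding corners_def using e f xf ye by blast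
qed

lemma corners_if_rectangular:
  assumes "slim_rectangular L"
  obtains e f where "corners E x y e f"
proof -
  obtain u v where uv: "u \<noteq> v" "join_irreducibles L \<inter> meet_irreducibles L = {u, v}" "complementary L u v"
    using assms by (auto simp: slim_rectangular_def)
  have M: "u \<in> meet_irreducibles L" "v \<in> meet_irreducibles L" using uv(2) by auto
  obtain e where e: "e \<in> E" "u = prin e" using meet_irreducible_prin[OF M(1)] .
  obtain f where f: "f \<in> E" "v = prin f" using meet_irreducible_prin[OF M(2)] .
  have irr: "h = e \<or> h = f" if "h \<in> E" "prin h \<in> join_irreducibles L" for h
  proof -
    have "prin h \<in> {u, v}" using that prin_meet_irreducible uv(2) by blast
    then show ?thesis using prin_inj e f that(1) by blast
  qed
  let ?W = "weakly_above E x y"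
  have disj: "?W e \<inter> ?W f = {}"
    using uv(3) e f cl_top cl_join[OF prin_closed prin_closed, of e f]
    by (simp add: complementary_def cl_prin)
  have full: "hull E x y (?W e \<union> ?W f) = E"
    using uv(3) e f cl_bottom cl_meet[OF prin_closed prin_closed, of e f]
    by (simp add: complementary_def cl_prin)
  have proper: "?W p \<noteq> E" if "prin p \<in> join_irreducibles L" for p
  proof
    assume "?W p = E"
    then have "prin p = \<bottom>\<^bsub>L\<^esub>" by (simp add: prin_def bottom_eq)
    then show False using that by (simp add: join_irreducibles_def)
  qed
  have ne: "?W e \<noteq> E" "?W f \<noteq> E" using proper uv(2) e f by auto
  have "(\<forall>p \<in> E. x e \<le> x p) \<or> (\<forall>p \<in> E. x f \<le> x p)"
  proof -
    have "E \<noteq> {}" using e by auto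
    then obtain a where a: "a \<in> E" "\<And>p. p \<in> E \<Longrightarrow> x a \<le> x p" using obtain_arg_min[of E x] by metis
    then have "a \<in> hull E x y (?W e \<union> ?W f)" using full by simp
    then have "x e \<le> x a \<or> x f \<le> x a" by (auto simp: hull_def weakly_above_def)
    then show ?thesis using a(2) order_trans by blast
  qed
  moreover have "(\<forall>p \<in> E. y e \<le> y p) \<or> (\<forall>p \<in> E. y f \<le> y p)"
  proof -
    have "E \<noteq> {}" using e by auto
    then obtain a where a: "a \<in> E" "\<And>p. p \<in> E \<Longrightarrow> y a \<le> y p" using obtain_arg_min[of E y] by metis
    then have "a \<in> hull E x y (?W e \<union> ?W f)" using full by simp
    then have "y e \<le> y a \<or> y f \<le> y a" by (auto simp: hull_def weakly_above_def)
    then show ?thesis using a(2) order_trans by blast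
  qed
  moreover have "\<not> ((\<forall>p \<in> E. x e \<le> x p) \<and> (\<forall>p \<in> E. y e \<le> y p))"
    using ne(1) by (auto simp: weakly_above_def)
  moreover have "\<not> ((\<forall>p \<in> E. x f \<le> x p) \<and> (\<forall>p \<in> E. y f \<le> y p))"
    using ne(2) by (auto simp: weakly_above_def)
  ultimately consider "\<forall>p \<in> E. x f \<le> x p" "\<forall>p \<in> E. y e \<le> y p" | "\<forall>p \<in> E. x e \<le> x p" "\<forall>p \<in> E. y f \<le> y p"
    by blast
  then show ?thesis
  proof cases
    case 1
    show ?thesis by (rule that, rule corners_if_irreducibles[OF e(1) f(1) 1 irr disj])
  next
    case 2
    have "corners E x y f e"
      by (rule corners_if_irreducibles[OF f(1) e(1) 2]) (use irr disj in auto)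
    then show ?thesis by (rule that)
  qed
qed

lemma corner_join_irreducible:
  assumes c: "corners E x y e f" shows "prin e \<in> join_irreducibles L"
proof -
  have e: "e \<in> E" and f: "f \<in> E" and ye: "\<And>p. p \<in> E \<Longrightarrow> y e \<le> y p" using c by (auto simp: corners_def)
  let ?P = "{r \<in> E. x r < x e}"
  have "finite ?P" "?P \<noteq> {}" using finite_E f corners_left_less[OF c] by auto
  then obtain g where g: "g \<in> ?P" and max: "\<And>r. r \<in> ?P \<Longrightarrow> x r \<le> x g"
    using obtain_arg_max[of ?P x] by metis
  have "y e \<noteq> y g" using y_eqD[OF e, of g] g by auto
  then have "y e < y g" using ye[of g] g by auto
  then show ?thesis using prin_join_irreducible[OF e ye, of g] g max by auto
qed

text \<open>If \<open>h\<close> lies to the left of \<open>e\<close>, then the hypothesis makes it as low as \<open>e\<close>.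
If it lies to the right, then it is in the chain above \<open>e\<close>, and its principal quadrant is the
intersection of the one of \<open>e\<close> with a half-plane, both of which are larger.\<close>

lemma corner_if_join_irreducible:
  assumes c: "corners E x y e f" and h: "h \<in> E" and irr: "prin h \<in> join_irreducibles L"
    and low: "\<And>r. \<lbrakk>r \<in> E; x h \<le> x r\<rbrakk> \<Longrightarrow> y h \<le> y r"
  shows "h = e"
proof (rule ccontr)
  assume ne: "h \<noteq> e"
  have e: "e \<in> E" and f: "f \<in> E" and ye: "\<And>p. p \<in> E \<Longrightarrow> y e \<le> y p"
    using c by (simp_all add: corners_def)
  have chain: "y p < y q" if "p \<in> E" "q \<in> E" "x e \<le> x p" "x p < x q" for p q
    using c that unfolding corners_def by blast
  have off: "y p < y f" if "p \<in> E" "x e \<le> x p" for p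
  proof -
    have "\<not> (x e \<le> x p \<and> y f \<le> y p)" using c that(1) unfolding corners_def by blast
    then show ?thesis using that(2) by simp
  qed
  have "\<not> x h \<le> x e" using low[OF e] ye[OF h] y_eqD[OF h e] ne by auto
  then have eh: "x e < x h" by simp
  have U: "{r \<in> E. y h \<le> y r} \<in> quadrants E x y" by (rule upper_quadrant)
  have "weakly_above E x y e \<inter> {r \<in> E. y h \<le> y r} = weakly_above E x y h"
  proof (intro equalityI subsetI)
    fix r assume r: "r \<in> weakly_above E x y e \<inter> {r \<in> E. y h \<le> y r}"
    then have "x h \<le> x r" using chain[of r h] h by (force simp: weakly_above_def not_le[symmetric])
    then show "r \<in> weakly_above E x y h" using r by (simp add: weakly_above_def)
  next
    fix r assume "r \<in> weakly_above E x y h"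
    then show "r \<in> weakly_above E x y e \<inter> {r \<in> E. y h \<le> y r}"
      using eh ye by (auto simp: weakly_above_def)
  qed
  then have "cl (prin h) = cl (prin e \<squnion>\<^bsub>L\<^esub> el {r \<in> E. y h \<le> y r})"
    by (simp add: cl_join[OF prin_closed el_closed[OF U]] cl_prin cl_el[OF U])
  then have "prin h = prin e \<squnion>\<^bsub>L\<^esub> el {r \<in> E. y h \<le> y r}"
    by (rule cl_inj[OF prin_closed lat.join_closed[OF prin_closed el_closed[OF U]]])
  then have "prin h = prin e \<or> prin h = el {r \<in> E. y h \<le> y r}"
    using irr prin_closed el_closed[OF U] by (auto simp: join_irreducibles_def)
  moreover have "prin h \<noteq> prin e" using prin_inj[OF h e] ne by blast
  ultimately have "weakly_above E x y h = {r \<in> E. y h \<le> y r}" using cl_prin[of h] cl_el[OF U] by simp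
  then have "f \<in> weakly_above E x y h" using f off[OF h] eh by simp
  then show False using corners_left_less[OF c] eh by (simp add: weakly_above_def)
qed

lemma rectangular_if_corners:
  assumes c: "corners E x y e f"
  shows "slim_rectangular L"
proof -
  interpret sw: quadrant_lattice E y x L cl by (rule quadrant_lattice_swap)
  have c': "corners E y x f e" using c by (simp add: corners_swap)
  have e: "e \<in> E" and f: "f \<in> E" and ye: "\<And>p. p \<in> E \<Longrightarrow> y e \<le> y p" and xf: "\<And>p. p \<in> E \<Longrightarrow> x f \<le> x p"
    and off: "\<And>p. p \<in> E \<Longrightarrow> \<not> (x e \<le> x p \<and> y f \<le> y p)"
    using c by (auto simp: corners_def)
  have "h = e \<or> h = f" if h: "h \<in> E" "prin h \<in> join_irreducibles L" for h
    using join_irreducible_half_plane[OF h(2)]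
  proof (elim disjE exE)
    fix i assume "cl (prin h) = {e \<in> E. i \<le> x e}"
    then have W: "weakly_above E x y h = {e \<in> E. i \<le> x e}" by (simp add: cl_prin)
    then have "i \<le> x h" using in_weakly_above[OF h(1)] by auto
    then have "y h \<le> y r" if "r \<in> E" "x h \<le> x r" for r
    proof -
      have "r \<in> weakly_above E x y h" unfolding W using that \<open>i \<le> x h\<close> by simp
      then show ?thesis by (simp add: weakly_above_def)
    qed
    then show ?thesis using corner_if_join_irreducible[OF c h] by blast
  next
    fix i assume "cl (prin h) = {e \<in> E. i \<le> y e}"
    then have W: "weakly_above E x y h = {e \<in> E. i \<le> y e}" by (simp add: cl_prin)
    then have "i \<le> y h" using in_weakly_above[OF h(1)] by auto
    then have "x h \<le> x r" if "r \<in> E" "y h \<le> y r" for r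
    proof -
      have "r \<in> weakly_above E x y h" unfolding W using that \<open>i \<le> y h\<close> by simp
      then show ?thesis by (simp add: weakly_above_def)
    qed
    then show ?thesis using sw.corner_if_join_irreducible[OF c' h(1)] h(2) by (simp add: prin_swap)
  qed
  moreover have "prin e \<in> join_irreducibles L" by (rule corner_join_irreducible[OF c])
  moreover have "prin f \<in> join_irreducibles L"
    using sw.corner_join_irreducible[OF c'] by (simp add: prin_swap)
  ultimately have "join_irreducibles L \<inter> meet_irreducibles L = {prin e, prin f}"
    using prin_meet_irreducible e f by (auto elim!: meet_irreducible_prin)
  moreover have "prin e \<noteq> prin f" using prin_inj[OF e f] corners_left_less[OF c] by auto
  moreover have "complementary L (prin e) (prin f)"
    unfolding complementary_def
  proof
    have "hull E x y (weakly_above E x y e \<union> weakly_above E x y f) = E"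
      using in_weakly_above[OF e] in_weakly_above[OF f] xf ye by (auto simp: hull_def)
    then have "cl (prin e \<sqinter>\<^bsub>L\<^esub> prin f) = E" by (simp add: cl_meet[OF prin_closed prin_closed] cl_prin)
    then show "prin e \<sqinter>\<^bsub>L\<^esub> prin f = \<bottom>\<^bsub>L\<^esub>"
      using el_cl[OF lat.meet_closed[OF prin_closed prin_closed], of e f] by (simp add: bottom_eq)
    have "weakly_above E x y e \<inter> weakly_above E x y f = {}"
      using off by (auto simp: weakly_above_def)
    then have "cl (prin e \<squnion>\<^bsub>L\<^esub> prin f) = {}" by (simp add: cl_join[OF prin_closed prin_closed] cl_prin)
    then show "prin e \<squnion>\<^bsub>L\<^esub> prin f = \<top>\<^bsub>L\<^esub>"
      using el_cl[OF lat.join_closed[OF prin_closed prin_closed], of e f] by (simp add: top_eq)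
  qed
  ultimately show ?thesis using slim unfolding slim_rectangular_def by blast
qed

lemma card_carrier_le:
  assumes c: "corners E x y e f"
  shows "card (carrier L) \<le> card E ^ 2"
proof -
  let ?g = "\<lambda>(p, q). el {r \<in> E. x p \<le> x r \<and> y q \<le> y r}"
  have "carrier L \<subseteq> ?g ` (E \<times> E)"
  proof
    fix a assume a: "a \<in> carrier L"
    have "\<exists>p \<in> E. \<exists>q \<in> E. cl a = {r \<in> E. x p \<le> x r \<and> y q \<le> y r}"
    proof (cases "cl a = {}")
      case True
      have "e \<in> E" "f \<in> E" "{r \<in> E. x e \<le> x r \<and> y f \<le> y r} = {}"
        using c by (auto simp: corners_def)
      then show ?thesis using True by metis
    next
      case False
      then obtain p q where "p \<in> cl a" "q \<in> cl a" and "\<forall>e \<in> cl a. x p \<le> x e" "\<forall>e \<in> cl a. y q \<le> y e"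
        and "cl a = {e \<in> E. x p \<le> x e \<and> y q \<le> y e}"
        by (rule quadrant_corner[OF finite_E cl_quadrant[OF a]])
      then show ?thesis using cl_subset[OF a] by blast
    qed
    then obtain p q where "p \<in> E" "q \<in> E" "cl a = {r \<in> E. x p \<le> x r \<and> y q \<le> y r}" by blast
    then show "a \<in> ?g ` (E \<times> E)" using el_cl[OF a] by force
  qed
  then have "card (carrier L) \<le> card (E \<times> E)"
    using finite_E by (intro surj_card_le) auto
  then show ?thesis by (simp add: card_cartesian_product power2_eq_square)
qed

end

section \<open>Coordinates for slim semimodular lattices\<close>

lemma bounded_lattice_if_finite:
  assumes K: "finite_lattice K" and a: "a \<in> carrier K"
  shows "bounded_lattice K"
proof -
  interpret lattice K using K by (simp add: finite_lattice_def)
  have fin: "finite (carrier K)" using K by (simp add: finite_lattice_def)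
  show ?thesis
  proof unfold_locales
    have "greatest K (\<Sqinter>\<^bsub>K\<^esub>(carrier K)) (Lower K (carrier K))"
      using a fin by (intro finite_inf_greatest) auto
    then have "least K (\<Sqinter>\<^bsub>K\<^esub>(carrier K)) (carrier K)"
      by (auto simp: least_def greatest_def Lower_def)
    then show "\<exists>b. least K b (carrier K)" ..
    have "least K (\<Squnion>\<^bsub>K\<^esub>(carrier K)) (Upper K (carrier K))"
      using a fin by (intro finite_sup_least) auto
    then have "greatest K (\<Squnion>\<^bsub>K\<^esub>(carrier K)) (carrier K)"
      by (auto simp: least_def greatest_def Upper_def)
    then show "\<exists>b. greatest K b (carrier K)" ..
  qed
qed

definition maximal_chain :: "'a gorder \<Rightarrow> 'a set \<Rightarrow> bool" where
  "maximal_chain K H \<longleftrightarrow> chain_in K H \<and>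
    (\<forall>z \<in> carrier K. (\<forall>h \<in> H. h \<sqsubseteq>\<^bsub>K\<^esub> z \<or> z \<sqsubseteq>\<^bsub>K\<^esub> h) \<longrightarrow> z \<in> H)"

definition height_in :: "'a gorder \<Rightarrow> 'a set \<Rightarrow> 'a \<Rightarrow> nat" where
  "height_in K H a = card {h \<in> H. h \<sqsubseteq>\<^bsub>K\<^esub> a}"

locale finite_bounded_lattice = bounded_lattice L for L :: "'a gorder" (structure) +
  assumes finite_carrier: "finite (carrier L)"
begin

lemma maximal_chain_extending:
  assumes C: "chain_in L C"
  obtains H where "maximal_chain L H" and "C \<subseteq> H"
proof -
  let ?S = "{H. chain_in L H \<and> C \<subseteq> H}"
  have "finite ?S"
    by (rule finite_subset[of _ "Pow (carrier L)"]) (auto simp: chain_in_def finite_carrier)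
  moreover have "?S \<noteq> {}" using C by auto
  ultimately obtain H where H: "H \<in> ?S" and max: "\<And>G. G \<in> ?S \<Longrightarrow> card G \<le> card H"
    using obtain_arg_max[of ?S card] by metis
  have "z \<in> H" if z: "z \<in> carrier L" "\<forall>h \<in> H. h \<sqsubseteq> z \<or> z \<sqsubseteq> h" for z
  proof (rule ccontr)
    assume "z \<notin> H"
    have "insert z H \<in> ?S" using H z by (auto simp: chain_in_def)
    then have "card (insert z H) \<le> card H" by (rule max)
    moreover have "finite H" using H finite_carrier by (auto simp: chain_in_def intro: finite_subset)
    ultimately show False using \<open>z \<notin> H\<close> by simp
  qed
  then have "maximal_chain L H" using H by (simp add: maximal_chain_def)
  then show ?thesis using that H by blast
qed

lemma chainD:
  assumes "chain_in L H"
  shows "h \<in> H \<Longrightarrow> h \<in> carrier L" and "\<lbrakk>h \<in> H; k \<in> H\<rbrakk> \<Longrightarrow> h \<sqsubseteq> k \<or> k \<sqsubseteq> h" and "finite H"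
  using assms finite_carrier by (auto simp: chain_in_def intro: finite_subset)

lemma height_le_iff:
  assumes H: "chain_in L H" and a: "a \<in> carrier L" and b: "b \<in> carrier L"
  shows "height_in L H a \<le> height_in L H b \<longleftrightarrow> (\<forall>h \<in> H. h \<sqsubseteq> a \<longrightarrow> h \<sqsubseteq> b)"
proof
  assume "\<forall>h \<in> H. h \<sqsubseteq> a \<longrightarrow> h \<sqsubseteq> b"
  then show "height_in L H a \<le> height_in L H b"
    unfolding height_in_def using chainD(3)[OF H] by (intro card_mono) auto
next
  assume le: "height_in L H a \<le> height_in L H b"
  show "\<forall>h \<in> H. h \<sqsubseteq> a \<longrightarrow> h \<sqsubseteq> b"
  proof (rule ccontr)
    assume "\<not> ?thesis"
    then obtain h where h: "h \<in> H" "h \<sqsubseteq> a" "\<not> h \<sqsubseteq> b" by blast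
    have "k \<sqsubseteq> a" if k: "k \<in> H" "k \<sqsubseteq> b" for k
    proof -
      have kc: "k \<in> carrier L" and hc: "h \<in> carrier L" using k h chainD(1)[OF H] by auto
      have "\<not> h \<sqsubseteq> k" using h(3) le_trans[OF _ k(2) hc kc b] by blast
      then have "k \<sqsubseteq> h" using chainD(2)[OF H] k h by blast
      then show ?thesis using le_trans[OF _ h(2) kc hc a] by blast
    qed
    then have "{h \<in> H. h \<sqsubseteq> b} \<subset> {h \<in> H. h \<sqsubseteq> a}" using h by blast
    then have "height_in L H b < height_in L H a"
      unfolding height_in_def using chainD(3)[OF H] by (intro psubset_card_mono) auto
    then show False using le by simp
  qed
qed

lemma chain_greatest:
  assumes H: "chain_in L H" and S: "S \<subseteq> H" "S \<noteq> {}"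
  obtains h where "h \<in> S" and "\<And>k. k \<in> S \<Longrightarrow> k \<sqsubseteq> h"
proof -
  have "finite S" using S chainD(3)[OF H] finite_subset by blast
  then obtain h where h: "h \<in> S" and max: "\<And>k. k \<in> S \<Longrightarrow> height_in L H k \<le> height_in L H h"
    using obtain_arg_max[OF _ S(2)] by metis
  have "k \<sqsubseteq> h" if k: "k \<in> S" for k
  proof -
    have "k \<in> carrier L" "h \<in> carrier L" using k h S chainD(1)[OF H] by auto
    then show ?thesis using max[OF k] height_le_iff[OF H] k S by blast
  qed
  then show ?thesis using that h by blast
qed

lemma chain_least:
  assumes H: "chain_in L H" and S: "S \<subseteq> H" "S \<noteq> {}"
  obtains h where "h \<in> S" and "\<And>k. k \<in> S \<Longrightarrow> h \<sqsubseteq> k"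
proof -
  obtain h where h: "h \<in> S" and min: "\<And>k. k \<in> S \<Longrightarrow> height_in L H h \<le> height_in L H k"
    using obtain_arg_min[OF S(2)] by metis
  have "h \<sqsubseteq> k" if k: "k \<in> S" for k
  proof -
    have "k \<in> carrier L" "h \<in> carrier L" using k h S chainD(1)[OF H] by auto
    then show ?thesis using min[OF k] height_le_iff[OF H] h S by blast
  qed
  then show ?thesis using that h by blast
qed

lemma bounds_in_maximal_chain:
  assumes "maximal_chain L H" shows "\<bottom> \<in> H" and "\<top> \<in> H"
proof -
  have "h \<in> carrier L" if "h \<in> H" for h using assms that by (auto simp: maximal_chain_def chain_in_def)
  then show "\<bottom> \<in> H" "\<top> \<in> H" using assms unfolding maximal_chain_def by auto
qed

text \<open>An element that is neither the bottom nor join-irreducible is a join of two smaller elements; the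
chain parts of these can be joined separately.\<close>

lemma join_of_chain_members:
  assumes H: "chain_in L H" and G: "chain_in L G" and bot: "\<bottom> \<in> H" "\<bottom> \<in> G"
    and J: "join_irreducibles L \<subseteq> H \<union> G" and a: "a \<in> carrier L"
  shows "\<exists>h \<in> H. \<exists>g \<in> G. a = h \<squnion> g"
  using a
proof (induction "card {z \<in> carrier L. z \<sqsubseteq> a}" arbitrary: a rule: less_induct)
  case less
  note a = less.prems
  have smaller: "\<exists>h \<in> H. \<exists>g \<in> G. b = h \<squnion> g" if b: "b \<in> carrier L" "b \<sqsubseteq> a" "b \<noteq> a" for b
  proof (rule less.hyps[OF _ b(1)])
    have "{z \<in> carrier L. z \<sqsubseteq> b} \<subset> {z \<in> carrier L. z \<sqsubseteq> a}"
    proof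
      show "{z \<in> carrier L. z \<sqsubseteq> b} \<subseteq> {z \<in> carrier L. z \<sqsubseteq> a}" using le_trans[OF _ b(2) _ b(1) a] by blast
      have "a \<notin> {z \<in> carrier L. z \<sqsubseteq> b}" using le_antisym[OF b(2) _ b(1) a] b(3) by blast
      then show "{z \<in> carrier L. z \<sqsubseteq> b} \<noteq> {z \<in> carrier L. z \<sqsubseteq> a}" using a by blast
    qed
    then show "card {z \<in> carrier L. z \<sqsubseteq> b} < card {z \<in> carrier L. z \<sqsubseteq> a}"
      using finite_carrier by (intro psubset_card_mono) auto
  qed
  have hb: "h \<squnion> \<bottom> = h" "\<bottom> \<squnion> h = h" if "h \<in> carrier L" for h
    using that by (auto intro!: le_antisym join_le join_left join_right)
  consider "a = \<bottom>" | "a \<in> join_irreducibles L" | "a \<noteq> \<bottom>" "a \<notin> join_irreducibles L" by blast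
  then show ?case
  proof cases
    case 1
    then have "a = \<bottom> \<squnion> \<bottom>" using hb(1)[OF a] by simp
    then show ?thesis by (intro bexI[OF _ bot(1)] bexI[OF _ bot(2)])
  next
    case 2
    then consider "a \<in> H" | "a \<in> G" using J by blast
    then show ?thesis
    proof cases
      case 1
      show ?thesis by (intro bexI[OF _ 1] bexI[OF _ bot(2)]) (simp add: hb(1)[OF a])
    next
      case 2
      show ?thesis by (intro bexI[OF _ bot(1)] bexI[OF _ 2]) (simp add: hb(2)[OF a])
    qed
  next
    case 3
    then obtain b d where bd: "b \<in> carrier L" "d \<in> carrier L" "a = b \<squnion> d" "a \<noteq> b" "a \<noteq> d"
      using a by (auto simp: join_irreducibles_def)
    obtain b1 b2 where b12: "b1 \<in> H" "b2 \<in> G" "b = b1 \<squnion> b2"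
      using smaller[OF bd(1)] bd join_left by metis
    obtain d1 d2 where d12: "d1 \<in> H" "d2 \<in> G" "d = d1 \<squnion> d2"
      using smaller[OF bd(2)] bd join_right by metis
    have c: "b1 \<in> carrier L" "b2 \<in> carrier L" "d1 \<in> carrier L" "d2 \<in> carrier L"
      using b12 d12 chainD(1)[OF H] chainD(1)[OF G] by auto
    have max: "p \<squnion> q \<in> {p, q}" if "p \<in> carrier L" "q \<in> carrier L" "p \<sqsubseteq> q \<or> q \<sqsubseteq> p" for p q
    proof -
      have "p \<squnion> q = q" if "p \<sqsubseteq> q" "p \<in> carrier L" "q \<in> carrier L" for p q
        using that by (intro le_antisym join_le join_right) auto
      then show ?thesis using that join_comm[of L p q] by auto
    qed
    have "b1 \<squnion> d1 \<in> H" "b2 \<squnion> d2 \<in> G"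
      using max[of b1 d1] max[of b2 d2] c b12 d12 chainD(2)[OF H, of b1 d1] chainD(2)[OF G, of b2 d2] by auto
    moreover have "a = (b1 \<squnion> d1) \<squnion> (b2 \<squnion> d2)"
    proof -
      have assoc: "(p \<squnion> q) \<squnion> r = p \<squnion> (q \<squnion> r)"
        if "p \<in> carrier L" "q \<in> carrier L" "r \<in> carrier L" for p q r
        using weak_join_assoc[OF that] by (simp add: eq_is_equal)
      have "a = b1 \<squnion> ((b2 \<squnion> d1) \<squnion> d2)" using bd(3) b12(3) d12(3) c by (simp add: assoc)
      also have "\<dots> = b1 \<squnion> ((d1 \<squnion> b2) \<squnion> d2)" by (simp only: join_comm[of L b2 d1])
      also have "\<dots> = (b1 \<squnion> d1) \<squnion> (b2 \<squnion> d2)" using c by (simp add: assoc)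
      finally show ?thesis .
    qed
    ultimately show ?thesis by blast
  qed
qed

lemma le_if_meet_irreducibles_le:
  assumes a: "a \<in> carrier L" and b: "b \<in> carrier L"
    and M: "\<And>m. \<lbrakk>m \<in> meet_irreducibles L; b \<sqsubseteq> m\<rbrakk> \<Longrightarrow> a \<sqsubseteq> m"
  shows "a \<sqsubseteq> b"
proof (rule ccontr)
  assume nab: "\<not> a \<sqsubseteq> b"
  let ?S = "{z \<in> carrier L. b \<sqsubseteq> z \<and> \<not> a \<sqsubseteq> z}"
  have "finite ?S" "?S \<noteq> {}" using finite_carrier b nab by auto
  obtain m where m: "m \<in> ?S"
    and max: "\<And>z. z \<in> ?S \<Longrightarrow> height_in L (carrier L) z \<le> height_in L (carrier L) m"
    by (rule obtain_arg_max[OF \<open>finite ?S\<close> \<open>?S \<noteq> {}\<close>, where z = "height_in L (carrier L)"])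
      (rule that; simp)
  have mc: "m \<in> carrier L" using m by simp
  have up: "a \<sqsubseteq> z" if z: "z \<in> carrier L" "m \<sqsubseteq> z" "m \<noteq> z" for z
  proof (rule ccontr)
    assume "\<not> a \<sqsubseteq> z"
    then have "z \<in> ?S" using z m le_trans[of b m z] b by blast
    then have "height_in L (carrier L) z \<le> height_in L (carrier L) m" by (rule max)
    moreover have "{h \<in> carrier L. h \<sqsubseteq> m} \<subset> {h \<in> carrier L. h \<sqsubseteq> z}"
    proof
      show "{h \<in> carrier L. h \<sqsubseteq> m} \<subseteq> {h \<in> carrier L. h \<sqsubseteq> z}" using le_trans[OF _ z(2) _ mc z(1)] by blast
      have "z \<notin> {h \<in> carrier L. h \<sqsubseteq> m}" using le_antisym[OF z(2) _ mc z(1)] z(3) by blast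
      then show "{h \<in> carrier L. h \<sqsubseteq> m} \<noteq> {h \<in> carrier L. h \<sqsubseteq> z}" using z(1) by blast
    qed
    then have "height_in L (carrier L) m < height_in L (carrier L) z"
      unfolding height_in_def using finite_carrier by (intro psubset_card_mono) auto
    ultimately show False by simp
  qed
  have "m \<in> meet_irreducibles L"
    unfolding meet_irreducibles_def
  proof (intro CollectI conjI ballI impI mc)
    show "m \<noteq> \<top>" using m a by auto
    fix p q assume pq: "p \<in> carrier L" "q \<in> carrier L" "m = p \<sqinter> q"
    show "m = p \<or> m = q"
    proof (rule ccontr)
      assume "\<not> (m = p \<or> m = q)"
      moreover have "m \<sqsubseteq> p" "m \<sqsubseteq> q" using pq meet_left meet_right by auto
      ultimately have "a \<sqsubseteq> p" "a \<sqsubseteq> q" using up pq by auto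
      then have "a \<sqsubseteq> m" using meet_le[of a p q] pq a by simp
      then show False using m by simp
    qed
  qed
  then show False using M m by blast
qed

text \<open>By semimodularity \<open>h' \<squnion> m\<close> covers \<open>m\<close>, and it is not below \<open>m'\<close>.
Hence \<open>m\<close> is the meet of \<open>h' \<squnion> m\<close> and \<open>m'\<close>.\<close>

lemma comparable_meet_irreducibles_eq:
  assumes semi: "semimodular_lattice L" and cov: "covers L h h'"
    and m: "m \<in> meet_irreducibles L" and m': "m' \<in> carrier L"
    and below: "h \<sqsubseteq> m" "\<not> h' \<sqsubseteq> m" "\<not> h' \<sqsubseteq> m'" and le: "m \<sqsubseteq> m'"
  shows "m = m'"
proof -
  have c: "h \<in> carrier L" "h' \<in> carrier L" "m \<in> carrier L"
    using cov m by (auto simp: covers_def meet_irreducibles_def)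
  let ?p = "h' \<squnion> m"
  have p: "?p \<in> carrier L" using c by simp
  have hm: "h \<squnion> m = m" using below(1) c by (intro le_antisym join_le join_right) auto
  have hp: "h' \<sqsubseteq> ?p" and mp: "m \<sqsubseteq> ?p" using c by (auto intro: join_left join_right)
  have "?p \<noteq> m" using hp below(2) by auto
  then have covp: "covers L m ?p"
    using semi cov c hm unfolding semimodular_lattice_def by metis
  let ?q = "?p \<sqinter> m'"
  have q: "?q \<in> carrier L" using p m' by simp
  have mq: "m \<sqsubseteq> ?q" using mp le c p m' by (intro meet_le) auto
  have qp: "?q \<sqsubseteq> ?p" and qm: "?q \<sqsubseteq> m'" using p m' by (auto intro: meet_left meet_right)
  have "?q \<noteq> ?p"
  proof
    assume "?q = ?p"
    then have "?p \<sqsubseteq> m'" using qm by simp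
    then show False using le_trans[OF hp _ c(2) p m'] below(3) by blast
  qed
  then have "m = ?q" using covp q mq qp by (auto simp: covers_def lless_def eq_is_equal)
  then have "m = ?p \<or> m = m'" using m p m' unfolding meet_irreducibles_def by blast
  then show ?thesis using \<open>?p \<noteq> m\<close> by auto
qed

text \<open>Two meet-irreducibles of the same height lie above the same element \<open>h\<close> of the maximal chain
\<open>H\<close> and not above the next element \<open>h'\<close>, which covers \<open>h\<close>. All elements
with this property are of the form \<open>h \<squnion> g\<close> with \<open>g\<close> in the other chain,
so they are comparable, and semimodularity leaves only one meet-irreducible among them.\<close>

lemma height_inj_on_meet_irreducibles:
  assumes semi: "semimodular_lattice L" and H: "maximal_chain L H" and G: "chain_in L G"
    and gen: "\<And>a. a \<in> carrier L \<Longrightarrow> \<exists>h \<in> H. \<exists>g \<in> G. a = h \<squnion> g"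
  shows "inj_on (height_in L H) (meet_irreducibles L)"
proof (rule inj_onI)
  fix m m' assume m: "m \<in> meet_irreducibles L" and m': "m' \<in> meet_irreducibles L"
    and eq: "height_in L H m = height_in L H m'"
  have mc: "m \<in> carrier L" "m' \<in> carrier L" and mt: "m \<noteq> \<top>"
    using m m' by (auto simp: meet_irreducibles_def)
  have cH: "chain_in L H" using H by (simp add: maximal_chain_def)
  note Hc = chainD(1)[OF cH]
  have same: "h \<sqsubseteq> m \<longleftrightarrow> h \<sqsubseteq> m'" if "h \<in> H" for h
    using height_le_iff[OF cH mc] height_le_iff[OF cH mc(2,1)] eq that by auto
  have "{h \<in> H. h \<sqsubseteq> m} \<noteq> {}" using bounds_in_maximal_chain(1)[OF H] mc by auto
  then obtain h where "h \<in> {h \<in> H. h \<sqsubseteq> m}" and "\<And>k. k \<in> {h \<in> H. h \<sqsubseteq> m} \<Longrightarrow> k \<sqsubseteq> h"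
    by (rule chain_greatest[OF cH, rotated]) auto
  then have h: "h \<in> H" "h \<sqsubseteq> m" and hmax: "\<And>k. \<lbrakk>k \<in> H; k \<sqsubseteq> m\<rbrakk> \<Longrightarrow> k \<sqsubseteq> h" by auto
  have "\<not> \<top> \<sqsubseteq> m" using mt mc le_antisym[of "\<top>" m] by auto
  then have "{h \<in> H. \<not> h \<sqsubseteq> m} \<noteq> {}" using bounds_in_maximal_chain(2)[OF H] by auto
  then obtain h' where "h' \<in> {h \<in> H. \<not> h \<sqsubseteq> m}" and "\<And>k. k \<in> {h \<in> H. \<not> h \<sqsubseteq> m} \<Longrightarrow> h' \<sqsubseteq> k"
    by (rule chain_least[OF cH, rotated]) auto
  then have h': "h' \<in> H" "\<not> h' \<sqsubseteq> m" and hmin: "\<And>k. \<lbrakk>k \<in> H; \<not> k \<sqsubseteq> m\<rbrakk> \<Longrightarrow> h' \<sqsubseteq> k" by auto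
  have hc: "h \<in> carrier L" "h' \<in> carrier L" using h h' Hc by auto
  have "\<not> h' \<sqsubseteq> h" using le_trans[OF _ h(2) hc(2,1) mc(1)] h'(2) by blast
  then have hh': "h \<sqsubseteq> h'" using chainD(2)[OF cH h(1) h'(1)] by blast
  have cov: "covers L h h'"
    unfolding covers_def
  proof (intro conjI hc notI)
    show "h \<sqsubset> h'" using hh' h(2) h'(2) by (auto simp: lless_def eq_is_equal)
    assume "\<exists>z \<in> carrier L. h \<sqsubset> z \<and> z \<sqsubset> h'"
    then obtain z where z: "z \<in> carrier L" "h \<sqsubseteq> z" "h \<noteq> z" "z \<sqsubseteq> h'" "z \<noteq> h'"
      by (auto simp: lless_def eq_is_equal)
    have "k \<sqsubseteq> z \<or> z \<sqsubseteq> k" if k: "k \<in> H" for k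
    proof (cases "k \<sqsubseteq> m")
      case True
      then show ?thesis using le_trans[OF hmax z(2) Hc hc(1) z(1)] k by blast
    next
      case False
      then show ?thesis using le_trans[OF z(4) hmin z(1) hc(2) Hc] k by blast
    qed
    then have zH: "z \<in> H" using H z(1) by (simp add: maximal_chain_def)
    show False
    proof (cases "z \<sqsubseteq> m")
      case True
      then show False using hmax[OF zH] le_antisym[OF z(2) _ hc(1) z(1)] z(3) by blast
    next
      case False
      then show False using hmin[OF zH] le_antisym[OF z(4) _ z(1) hc(2)] z(5) by blast
    qed
  qed
  have split: "\<exists>g \<in> G. a = h \<squnion> g"
    if a: "a \<in> carrier L" "h \<sqsubseteq> a" "\<And>k. \<lbrakk>k \<in> H; k \<sqsubseteq> a\<rbrakk> \<Longrightarrow> k \<sqsubseteq> h" for a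
  proof -
    obtain c g where cg: "c \<in> H" "g \<in> G" "a = c \<squnion> g" using gen[OF a(1)] by blast
    have car: "c \<in> carrier L" "g \<in> carrier L" using cg Hc chainD(1)[OF G] by auto
    have ca: "c \<sqsubseteq> a" "g \<sqsubseteq> a" using cg(3) car by (auto intro: join_left join_right)
    have "c \<sqsubseteq> h" using a(3)[OF cg(1) ca(1)] .
    then have "c \<sqsubseteq> h \<squnion> g" using le_trans[OF _ join_left[OF hc(1) car(2)] car(1) hc(1)] hc car by simp
    then have "a \<sqsubseteq> h \<squnion> g" unfolding cg(3) using car hc by (intro join_le join_right) auto
    moreover have "h \<squnion> g \<sqsubseteq> a" using a ca car hc by (intro join_le) auto
    ultimately have "a = h \<squnion> g"
      using le_antisym[OF _ _ a(1) join_closed[OF hc(1) car(2)]] by simp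
    then show ?thesis using cg(2) by blast
  qed
  obtain g where g: "g \<in> G" "m = h \<squnion> g" using split[OF mc(1) h(2) hmax] by blast
  have "h \<sqsubseteq> m'" using same h by blast
  have "\<exists>g \<in> G. m' = h \<squnion> g"
    by (rule split[OF mc(2) \<open>h \<sqsubseteq> m'\<close>]) (simp add: hmax same)
  then obtain g' where g': "g' \<in> G" "m' = h \<squnion> g'" by blast
  have gc: "g \<in> carrier L" "g' \<in> carrier L" using g g' chainD(1)[OF G] by auto
  have mono: "h \<squnion> p \<sqsubseteq> h \<squnion> q" if "p \<in> carrier L" "q \<in> carrier L" "p \<sqsubseteq> q" for p q
    using that hc le_trans[OF that(3) join_right[OF hc(1) that(2)]]
    by (intro join_le join_left) auto
  have "m \<sqsubseteq> m' \<or> m' \<sqsubseteq> m"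
    using chainD(2)[OF G g(1) g'(1)] mono[OF gc] mono[OF gc(2,1)] g(2) g'(2) by auto
  moreover have "\<not> h' \<sqsubseteq> m'" using same[OF h'(1)] h'(2) by simp
  ultimately show "m = m'"
    using comparable_meet_irreducibles_eq[OF semi cov m mc(2) h(2) h'(2)]
      comparable_meet_irreducibles_eq[OF semi cov m' mc(1) \<open>h \<sqsubseteq> m'\<close> _ h'(2)] by auto
qed

text \<open>If \<open>a = h \<squnion> g\<close> with \<open>h\<close> and \<open>g\<close> in the two chains, then a
meet-irreducible is above \<open>a\<close> if and only if its first height is large enough to be above
\<open>h\<close> and its second height is large enough to be above \<open>g\<close>.\<close>

lemma quadrant_lattice_of_chains:
  assumes semi: "semimodular_lattice L" and H: "maximal_chain L H" and G: "maximal_chain L G"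
    and J: "join_irreducibles L \<subseteq> H \<union> G"
  shows "quadrant_lattice (meet_irreducibles L) (height_in L H) (height_in L G) L
    (\<lambda>a. {m \<in> meet_irreducibles L. a \<sqsubseteq> m})"
proof -
  let ?M = "meet_irreducibles L" and ?x = "height_in L H" and ?y = "height_in L G"
  let ?cl = "\<lambda>a. {m \<in> meet_irreducibles L. a \<sqsubseteq> m}"
  have cH: "chain_in L H" and cG: "chain_in L G" using H G by (auto simp: maximal_chain_def)
  note Hc = chainD(1)[OF cH] and Gc = chainD(1)[OF cG]
  have Mc: "m \<in> carrier L" if "m \<in> ?M" for m using that by (simp add: meet_irreducibles_def)
  have gen: "\<exists>h \<in> H. \<exists>g \<in> G. a = h \<squnion> g" if "a \<in> carrier L" for a
    using join_of_chain_members[OF cH cG bounds_in_maximal_chain(1)[OF H]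
        bounds_in_maximal_chain(1)[OF G] J that] .
  have gen': "\<exists>h \<in> G. \<exists>g \<in> H. a = h \<squnion> g" if a: "a \<in> carrier L" for a
  proof -
    obtain h g where hg: "h \<in> H" "g \<in> G" "a = h \<squnion> g" using gen[OF a] by blast
    then have "a = g \<squnion> h" using join_comm[of L h g] by simp
    then show ?thesis using hg by blast
  qed
  have le: "a \<sqsubseteq> b \<longleftrightarrow> ?cl b \<subseteq> ?cl a" if "a \<in> carrier L" "b \<in> carrier L" for a b
  proof
    assume "a \<sqsubseteq> b"
    then show "?cl b \<subseteq> ?cl a" using le_trans[OF \<open>a \<sqsubseteq> b\<close> _ that Mc] by auto
  next
    assume sub: "?cl b \<subseteq> ?cl a"
    show "a \<sqsubseteq> b" by (rule le_if_meet_irreducibles_le[OF that]) (use sub in auto)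
  qed
  have join_iff: "h \<squnion> g \<sqsubseteq> m \<longleftrightarrow> h \<sqsubseteq> m \<and> g \<sqsubseteq> m"
    if c: "h \<in> carrier L" "g \<in> carrier L" "m \<in> carrier L" for h g m
  proof
    assume "h \<squnion> g \<sqsubseteq> m"
    then show "h \<sqsubseteq> m \<and> g \<sqsubseteq> m"
      using le_trans[OF join_left[OF c(1,2)] _ c(1) join_closed[OF c(1,2)] c(3)]
        le_trans[OF join_right[OF c(1,2)] _ c(2) join_closed[OF c(1,2)] c(3)] by simp
  next
    assume "h \<sqsubseteq> m \<and> g \<sqsubseteq> m"
    then show "h \<squnion> g \<sqsubseteq> m" using c by (intro join_le) auto
  qed
  have closed: "?cl a \<in> quadrants ?M ?x ?y" if a: "a \<in> carrier L" for a
    unfolding quadrants_def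
  proof (rule CollectI, intro conjI ballI impI)
    fix p q e assume p: "p \<in> ?cl a" and q: "q \<in> ?cl a" and e: "e \<in> ?M"
      and xy: "?x p \<le> ?x e \<and> ?y q \<le> ?y e"
    obtain h g where hg: "h \<in> H" "g \<in> G" "a = h \<squnion> g" using gen[OF a] by blast
    have c: "h \<in> carrier L" "g \<in> carrier L" "p \<in> carrier L" "q \<in> carrier L" "e \<in> carrier L"
      using hg Hc Gc p q e Mc by auto
    have "h \<sqsubseteq> p" "g \<sqsubseteq> q" using p q hg(3) join_iff c by auto
    then have "h \<sqsubseteq> e" "g \<sqsubseteq> e"
      using xy height_le_iff[OF cH c(3,5)] height_le_iff[OF cG c(4,5)] hg by auto
    then show "e \<in> ?cl a" using e hg(3) join_iff c by auto
  qed auto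
  have surj: "\<exists>a \<in> carrier L. ?cl a = A" if A: "A \<in> quadrants ?M ?x ?y" for A
  proof (cases "A = {}")
    case True
    have "\<not> \<top> \<sqsubseteq> m" if "m \<in> ?M" for m
      using that le_antisym[of "\<top>" m] by (auto simp: meet_irreducibles_def)
    then have "?cl \<top> = A" using True by auto
    then show ?thesis by blast
  next
    case False
    have fin: "finite ?M" using finite_carrier Mc by (auto intro: finite_subset)
    obtain p q where pq: "p \<in> A" "q \<in> A" and "\<forall>e \<in> A. ?x p \<le> ?x e" "\<forall>e \<in> A. ?y q \<le> ?y e"
      and eq: "A = {e \<in> ?M. ?x p \<le> ?x e \<and> ?y q \<le> ?y e}"
      by (rule quadrant_corner[OF fin A False])
    have pqc: "p \<in> carrier L" "q \<in> carrier L" using pq quadrants_subset[OF A] Mc by auto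
    have below: "\<exists>h \<in> C. \<forall>e \<in> carrier L. height_in L C r \<le> height_in L C e \<longleftrightarrow> h \<sqsubseteq> e"
      if C: "maximal_chain L C" and r: "r \<in> carrier L" for C r
    proof -
      have cC: "chain_in L C" using C by (simp add: maximal_chain_def)
      have "{h \<in> C. h \<sqsubseteq> r} \<noteq> {}" using bounds_in_maximal_chain(1)[OF C] r by auto
      then obtain h where h: "h \<in> {h \<in> C. h \<sqsubseteq> r}" and max: "\<And>k. k \<in> {h \<in> C. h \<sqsubseteq> r} \<Longrightarrow> k \<sqsubseteq> h"
        by (rule chain_greatest[OF cC, rotated]) auto
      have "height_in L C r \<le> height_in L C e \<longleftrightarrow> h \<sqsubseteq> e" if e: "e \<in> carrier L" for e
        unfolding height_le_iff[OF cC r e]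
      proof
        assume "\<forall>k \<in> C. k \<sqsubseteq> r \<longrightarrow> k \<sqsubseteq> e" then show "h \<sqsubseteq> e" using h by blast
      next
        assume he: "h \<sqsubseteq> e"
        show "\<forall>k \<in> C. k \<sqsubseteq> r \<longrightarrow> k \<sqsubseteq> e"
        proof (intro ballI impI)
          fix k assume k: "k \<in> C" "k \<sqsubseteq> r"
          then have "k \<sqsubseteq> h" using max by blast
          moreover have "k \<in> carrier L" "h \<in> carrier L" using k(1) h chainD(1)[OF cC] by auto
          ultimately show "k \<sqsubseteq> e" using le_trans[OF _ he _ _ e] by simp
        qed
      qed
      then show ?thesis using h by blast
    qed
    obtain h where h: "h \<in> H" "\<And>e. e \<in> carrier L \<Longrightarrow> ?x p \<le> ?x e \<longleftrightarrow> h \<sqsubseteq> e"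
      using below[OF H pqc(1)] by blast
    obtain g where g: "g \<in> G" "\<And>e. e \<in> carrier L \<Longrightarrow> ?y q \<le> ?y e \<longleftrightarrow> g \<sqsubseteq> e"
      using below[OF G pqc(2)] by blast
    have c: "h \<in> carrier L" "g \<in> carrier L" using h(1) g(1) Hc Gc by auto
    have "?cl (h \<squnion> g) = A"
      unfolding eq using h(2) g(2) join_iff[OF c] Mc by auto
    then show ?thesis using join_closed[OF c] by blast
  qed
  show ?thesis
  proof unfold_locales
    show "finite ?M" using finite_carrier Mc by (auto intro: finite_subset)
    show "inj_on ?x ?M" by (rule height_inj_on_meet_irreducibles[OF semi H cG gen])
    show "inj_on ?y ?M" by (rule height_inj_on_meet_irreducibles[OF semi G cH gen'])
    show "(.=) = (=)" by (rule eq_is_equal)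
    show "bij_betw ?cl (carrier L) (quadrants ?M ?x ?y)"
      unfolding bij_betw_def
    proof
      show "inj_on ?cl (carrier L)"
      proof (rule inj_onI)
        fix a b assume c: "a \<in> carrier L" "b \<in> carrier L" and "?cl a = ?cl b"
        then have "a \<sqsubseteq> b" "b \<sqsubseteq> a" unfolding le[OF c] le[OF c(2,1)] by simp_all
        then show "a = b" using c by (rule le_antisym)
      qed
      show "?cl ` carrier L = quadrants ?M ?x ?y"
      proof
        show "?cl ` carrier L \<subseteq> quadrants ?M ?x ?y" using closed by blast
        show "quadrants ?M ?x ?y \<subseteq> ?cl ` carrier L" using surj by blast
      qed
    qed
    show "a \<sqsubseteq> b \<longleftrightarrow> ?cl b \<subseteq> ?cl a" if "a \<in> carrier L" "b \<in> carrier L" for a b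
      using le[OF that] .
  qed
qed

end

theorem slim_semimodular_quadrant_lattice:
  fixes K :: "'a gorder"
  assumes K: "slim_semimodular K" and ne: "a \<in> carrier K"
  obtains x y where "quadrant_lattice (meet_irreducibles K) x y K (\<lambda>a. {m \<in> meet_irreducibles K. a \<sqsubseteq>\<^bsub>K\<^esub> m})"
proof -
  obtain C1 C2 where fin: "finite_lattice K" and semi: "semimodular_lattice K"
    and C: "chain_in K C1" "chain_in K C2" "join_irreducibles K = C1 \<union> C2"
    using K by (auto simp: slim_semimodular_def)
  interpret bounded_lattice K by (rule bounded_lattice_if_finite[OF fin ne])
  interpret finite_bounded_lattice K
    by unfold_locales (use fin in \<open>simp add: finite_lattice_def\<close>)
  obtain H where H: "maximal_chain K H" "C1 \<subseteq> H" by (rule maximal_chain_extending[OF C(1)])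
  obtain G where G: "maximal_chain K G" "C2 \<subseteq> G" by (rule maximal_chain_extending[OF C(2)])
  show ?thesis
    by (rule that, rule quadrant_lattice_of_chains[OF semi H(1) G(1)]) (use C H G in auto)
qed

section \<open>Thinning out the point set\<close>

text \<open>Two points have the same cone if and only if each of them can be reached from the other along lit points.
The set of all cones serves as the index set of these classes.\<close>

definition lit_cone :: "'p set \<Rightarrow> ('p \<Rightarrow> nat) \<Rightarrow> ('p \<Rightarrow> nat) \<Rightarrow> 'p \<Rightarrow> 'p set" where
  "lit_cone E x y p = {q \<in> E. (lit E x y)\<^sup>*\<^sup>* q p}"

lemma lit_in: "lit E x y p q \<Longrightarrow> p \<in> E \<and> q \<in> E"
  by (auto simp: lit_def lit_below_def)

lemma lit_closed_empty: "{} \<in> lit_closed E x y"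
  by (simp add: lit_closed_def)

lemma lit_closed_Un:
  "\<lbrakk>S \<in> lit_closed E x y; T \<in> lit_closed E x y\<rbrakk> \<Longrightarrow> S \<union> T \<in> lit_closed E x y"
  unfolding lit_closed_def by blast

lemma lit_cone_least:
  assumes "p \<in> E"
  shows "lit_cone E x y p \<in> lit_closed E x y \<and> p \<in> lit_cone E x y p \<and>
    (\<forall>T \<in> lit_closed E x y. p \<in> T \<longrightarrow> lit_cone E x y p \<subseteq> T)"
proof (intro conjI ballI impI)
  show "lit_cone E x y p \<in> lit_closed E x y"
    by (auto simp: lit_closed_def lit_cone_def dest: lit_in intro: converse_rtranclp_into_rtranclp)
  show "p \<in> lit_cone E x y p" using assms by (simp add: lit_cone_def)
  fix T assume T: "T \<in> lit_closed E x y" and p: "p \<in> T"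
  have "q \<in> T" if "(lit E x y)\<^sup>*\<^sup>* q p" for q
    using that
  proof (induction rule: converse_rtranclp_induct)
    case base
    show ?case by (rule p)
  next
    case (step q r)
    then show ?case using T unfolding lit_closed_def by blast
  qed
  then show "lit_cone E x y p \<subseteq> T" by (auto simp: lit_cone_def)
qed

lemma same_lit_cone_mem:
  assumes "T \<in> lit_closed E x y" "p \<in> T" "q \<in> E" "lit_cone E x y p = lit_cone E x y q"
  shows "q \<in> T"
proof -
  have "p \<in> E" using assms(1,2) by (auto simp: lit_closed_def)
  then show ?thesis using lit_cone_least[of p E x y] lit_cone_least[OF assms(3), of x y] assms by blast
qed

text \<open>A point strictly above \<open>f\<close> is on the far side of the strip in which \<open>p\<close> lies, and it is
higher than \<open>f\<close>, hence higher than \<open>p\<close>.\<close>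

lemma lit_strictly_above:
  assumes "lit E x y p f" shows "strictly_above E x y f \<subseteq> strictly_above E x y p"
  using assms unfolding lit_def
proof
  assume "lit_below E x y p f"
  then show ?thesis by (fastforce simp: lit_below_def strictly_above_def)
next
  assume "lit_below E y x p f"
  then show ?thesis by (fastforce simp: lit_below_def strictly_above_def)
qed

lemma lit_cone_strictly_above:
  assumes "q \<in> lit_cone E x y p" shows "strictly_above E x y p \<subseteq> strictly_above E x y q"
proof -
  have "(lit E x y)\<^sup>*\<^sup>* q p" using assms by (simp add: lit_cone_def)
  then show ?thesis
  proof (induction rule: converse_rtranclp_induct)
    case (step q r)
    then show ?case using lit_strictly_above[OF step(1)] by simp
  qed simp
qed

lemma same_lit_cone_strictly_above:
  assumes "p \<in> E" "q \<in> E" "lit_cone E x y p = lit_cone E x y q"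
  shows "strictly_above E x y p = strictly_above E x y q"
proof
  have "p \<in> lit_cone E x y q" "q \<in> lit_cone E x y p"
    using lit_cone_least[OF assms(1), of x y] lit_cone_least[OF assms(2), of x y] assms(3) by auto
  then show "strictly_above E x y p \<subseteq> strictly_above E x y q" "strictly_above E x y q \<subseteq> strictly_above E x y p"
    by (simp_all add: lit_cone_strictly_above)
qed

text \<open>The lighting point itself is one of these two points, and the existence of the other one is part of the
definition. So whether the last condition of \<open>lit_below\<close> or its mirror image is satisfied does
not depend on the direction from which \<open>p\<close> is lit.\<close>

lemma lit_interior:
  assumes "lit E x y p f"
  shows "(\<exists>c \<in> E. x p < x c \<and> y c < y p) \<and> (\<exists>c \<in> E. x c < x p \<and> y p < y c)"
  using assms by (auto simp: lit_def lit_below_def)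

text \<open>The lowest corner is a witness for the last condition of \<open>lit_below\<close> whenever there is one, so
this condition survives the passage to a subset that contains the corners.\<close>

lemma right_below_corner:
  assumes c: "corners E x y e f" and p: "p \<in> E" and r: "r \<in> E" "x p < x r" "y r < y p"
  shows "x p < x e \<and> y e < y p"
proof
  have "\<not> x e \<le> x p"
  proof
    assume "x e \<le> x p"
    then have "y p < y r" using c p r unfolding corners_def by blast
    then show False using r by simp
  qed
  then show "x p < x e" by simp
  have "y e \<le> y r" using c r by (simp add: corners_def)
  then show "y e < y p" using r by simp
qed

text \<open>Removing points can only widen the strip below \<open>q\<close>; it stays the same if a leftmost point strictly
above \<open>q\<close> is kept.\<close>

lemma lit_below_subset_iff:
  assumes c: "corners E x y e f" and S: "S \<subseteq> E" and e: "e \<in> S" and p: "p \<in> S" and q: "q \<in> S"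
    and left: "strictly_above E x y q \<noteq> {} \<Longrightarrow>
      \<exists>a \<in> S. a \<in> strictly_above E x y q \<and> (\<forall>h \<in> strictly_above E x y q. x a \<le> x h)"
  shows "lit_below S x y p q \<longleftrightarrow> lit_below E x y p q"
proof
  assume l: "lit_below S x y p q"
  have "x p < x g" if g: "g \<in> strictly_above E x y q" for g
  proof -
    obtain a where a: "a \<in> S" "a \<in> strictly_above E x y q" "x a \<le> x g" using left g by blast
    then have "a \<in> strictly_above S x y q" by (simp add: strictly_above_def)
    then have "x p < x a" using l by (simp add: lit_below_def)
    then show ?thesis using a by simp
  qed
  then show "lit_below E x y p q" using l S by (auto simp: lit_below_def)
next
  assume l: "lit_below E x y p q"
  then obtain r where r: "r \<in> E" "x p < x r" "y r < y p" by (auto simp: lit_below_def)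
  have "p \<in> E" using p S by blast
  then have "x p < x e \<and> y e < y p" using right_below_corner[OF c _ r] by blast
  moreover have "strictly_above S x y q \<subseteq> strictly_above E x y q" using S by (auto simp: strictly_above_def)
  ultimately show "lit_below S x y p q" using l e p q by (auto simp: lit_below_def)
qed

lemma lit_subset_iff:
  assumes c: "corners E x y e f" and S: "S \<subseteq> E" and ef: "e \<in> S" "f \<in> S" and p: "p \<in> S" and q: "q \<in> S"
    and left: "strictly_above E x y q \<noteq> {} \<Longrightarrow>
      \<exists>a \<in> S. a \<in> strictly_above E x y q \<and> (\<forall>h \<in> strictly_above E x y q. x a \<le> x h)"
    and low: "strictly_above E x y q \<noteq> {} \<Longrightarrow>
      \<exists>a \<in> S. a \<in> strictly_above E x y q \<and> (\<forall>h \<in> strictly_above E x y q. y a \<le> y h)"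
  shows "lit S x y p q \<longleftrightarrow> lit E x y p q"
proof -
  have c': "corners E y x f e" using c by (simp add: corners_swap)
  have "lit_below S x y p q \<longleftrightarrow> lit_below E x y p q"
    by (rule lit_below_subset_iff[OF c S ef(1) p q left])
  moreover have "lit_below S y x p q \<longleftrightarrow> lit_below E y x p q"
    by (rule lit_below_subset_iff[OF c' S ef(2) p q]) (use low in \<open>simp add: strictly_above_swap[of E y x]\<close>)
  ultimately show ?thesis by (simp add: lit_def)
qed

context planar_points
begin

text \<open>The two points have the same points strictly above them, so neither is strictly above the other; then one
of them is to the right of and below the other. Since the bounding points of their strips are the same
ones, each lies within a strip of the other.\<close>

lemma lit_if_same_lit_cone:
  assumes p: "p \<in> E" and q: "q \<in> E" and cone: "lit_cone E x y p = lit_cone E x y q" and ne: "p \<noteq> q"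
  shows "lit E x y p q"
proof -
  have SA: "strictly_above E x y p = strictly_above E x y q"
    by (rule same_lit_cone_strictly_above[OF p q cone])
  have "p \<in> lit_cone E x y q" using lit_cone_least[OF p, of x y] cone by auto
  then have "(lit E x y)\<^sup>*\<^sup>* p q" by (simp add: lit_cone_def)
  then obtain r where r: "lit E x y p r" using ne by (auto elim: converse_rtranclpE)
  have int: "\<exists>c \<in> E. x p < x c \<and> y c < y p" "\<exists>c \<in> E. x c < x p \<and> y p < y c"
    using lit_interior[OF r] by simp_all
  have "p \<notin> strictly_above E x y q" "q \<notin> strictly_above E x y p"
    using SA not_in_strictly_above by auto
  moreover have "x p \<noteq> x q" "y p \<noteq> y q" using x_eqD[OF p q] y_eqD[OF p q] ne by auto
  ultimately consider "x q < x p" "y p < y q" | "y q < y p" "x p < x q"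
    using p q by (fastforce simp: strictly_above_def)
  then show ?thesis
  proof cases
    case 1
    have "\<forall>g \<in> strictly_above E x y q. x p < x g"
      unfolding SA[symmetric] by (simp add: strictly_above_def)
    then have "lit_below E x y p q" using 1 p q int(1) by (simp add: lit_below_def)
    then show ?thesis by (simp add: lit_def)
  next
    case 2
    have "\<forall>g \<in> strictly_above E y x q. y p < y g"
      unfolding strictly_above_swap[of E y x] SA[symmetric] by (simp add: strictly_above_def)
    then have "lit_below E y x p q" using 2 p q int(2) by (auto simp: lit_below_def)
    then show ?thesis by (simp add: lit_def)
  qed
qed

lemma corner_lit_cone:
  assumes c: "corners E x y e f" and s: "s \<in> E"
  shows "lit_cone E x y s = lit_cone E x y e \<Longrightarrow> s = e"
    and "lit_cone E x y s = lit_cone E x y f \<Longrightarrow> s = f"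
proof -
  have ef: "e \<in> E" "f \<in> E" and min: "\<And>p. p \<in> E \<Longrightarrow> y e \<le> y p" "\<And>p. p \<in> E \<Longrightarrow> x f \<le> x p"
    using c by (simp_all add: corners_def)
  have "\<not> lit E x y e q" for q
    using lit_interior[of E x y e q] min(1) by (meson leD)
  moreover have "\<not> lit E x y f q" for q
    using lit_interior[of E x y f q] min(2) by (meson leD)
  ultimately show "lit_cone E x y s = lit_cone E x y e \<Longrightarrow> s = e" "lit_cone E x y s = lit_cone E x y f \<Longrightarrow> s = f"
    using lit_if_same_lit_cone[OF ef(1) s] lit_if_same_lit_cone[OF ef(2) s] by auto
qed

text \<open>A closed set is a union of classes. The inverse map sends a closed set of the remaining points to the union
of the classes that it meets.\<close>

lemma lit_closed_restrict_iso:
  assumes S: "S \<subseteq> E" and rep: "\<And>p. p \<in> E \<Longrightarrow> \<exists>s \<in> S. lit_cone E x y s = lit_cone E x y p"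
    and wit: "\<And>p q. lit E x y p q \<Longrightarrow> \<exists>s \<in> S. \<exists>t \<in> S. lit_cone E x y s = lit_cone E x y p \<and>
      lit_cone E x y t = lit_cone E x y q \<and> lit E x y s t"
    and lit: "\<And>p q. \<lbrakk>p \<in> S; q \<in> S\<rbrakk> \<Longrightarrow> lit S x y p q \<longleftrightarrow> lit E x y p q"
  shows "order_iso (inclusion_order (lit_closed E x y)) (inclusion_order (lit_closed S x y)) (\<lambda>T. T \<inter> S)"
proof -
  let ?cone = "lit_cone E x y"
  define sat where "sat T = {p \<in> E. \<exists>s \<in> T. ?cone s = ?cone p}" for T
  have restrict: "T \<inter> S \<in> lit_closed S x y" if T: "T \<in> lit_closed E x y" for T
  proof -
    have "p \<in> T \<inter> S" if "lit S x y p q" "q \<in> T \<inter> S" for p q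
    proof -
      have "p \<in> S" "q \<in> S" using lit_in[OF that(1)] by auto
      then show ?thesis using lit that T unfolding lit_closed_def by blast
    qed
    then show ?thesis unfolding lit_closed_def by blast
  qed
  have same_class: "t \<in> T" if T: "T \<in> lit_closed S x y" and s: "s \<in> T" and t: "t \<in> S" "?cone s = ?cone t" for T s t
  proof (cases "t = s")
    case True
    then show ?thesis using s by simp
  next
    case False
    have sS: "s \<in> S" using T s by (auto simp: lit_closed_def)
    then have "lit E x y t s" using lit_if_same_lit_cone[of t s] t S False by auto
    then have "lit S x y t s" using lit t sS by blast
    then show ?thesis using T s unfolding lit_closed_def by blast
  qed
  have sat_closed: "sat T \<in> lit_closed E x y" if T: "T \<in> lit_closed S x y" for T
  proof -
    have "p \<in> sat T" if pq: "lit E x y p q" "q \<in> sat T" for p q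
    proof -
      obtain r where r: "r \<in> T" "?cone r = ?cone q" using pq(2) by (auto simp: sat_def)
      obtain s t where st: "s \<in> S" "t \<in> S" "?cone s = ?cone p" "?cone t = ?cone q" "lit E x y s t"
        using wit[OF pq(1)] by blast
      have "t \<in> T" using same_class[OF T r(1) st(2)] r(2) st(4) by simp
      moreover have "lit S x y s t" using lit[OF st(1,2)] st(5) by simp
      ultimately have "s \<in> T" using T unfolding lit_closed_def by blast
      then show ?thesis using st(3) lit_in[OF pq(1)] by (auto simp: sat_def)
    qed
    moreover have "sat T \<subseteq> E" by (auto simp: sat_def)
    ultimately show ?thesis unfolding lit_closed_def by blast
  qed
  have sat_restrict: "sat (T \<inter> S) = T" if T: "T \<in> lit_closed E x y" for T
  proof
    show "sat (T \<inter> S) \<subseteq> T" using same_lit_cone_mem[OF T] by (auto simp: sat_def)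
    show "T \<subseteq> sat (T \<inter> S)"
    proof
      fix p assume p: "p \<in> T"
      then have pE: "p \<in> E" using T by (auto simp: lit_closed_def)
      obtain s where s: "s \<in> S" "?cone s = ?cone p" using rep[OF pE] by blast
      then have "s \<in> T" using same_lit_cone_mem[OF T p, of s] S by auto
      then show "p \<in> sat (T \<inter> S)" using s pE by (auto simp: sat_def)
    qed
  qed
  have restrict_sat: "sat T \<inter> S = T" if T: "T \<in> lit_closed S x y" for T
  proof
    show "sat T \<inter> S \<subseteq> T" using same_class[OF T] by (auto simp: sat_def)
    show "T \<subseteq> sat T \<inter> S" using T S by (auto simp: sat_def lit_closed_def)
  qed
  show ?thesis
    unfolding order_iso_def inclusion_order_simps
  proof (intro conjI ballI)
    show "bij_betw (\<lambda>T. T \<inter> S) (lit_closed E x y) (lit_closed S x y)"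
      by (rule bij_betwI[where g = sat]) (simp_all add: restrict sat_closed sat_restrict restrict_sat)
    fix T U assume T: "T \<in> lit_closed E x y" and U: "U \<in> lit_closed E x y"
    have "sat (T \<inter> S) \<subseteq> sat (U \<inter> S)" if "T \<inter> S \<subseteq> U \<inter> S" using that by (auto simp: sat_def)
    then show "T \<subseteq> U \<longleftrightarrow> T \<inter> S \<subseteq> U \<inter> S" unfolding sat_restrict[OF T] sat_restrict[OF U] by blast
  qed
qed

lemma class_extremal_point:
  fixes z :: "'p \<Rightarrow> nat"
  shows "\<exists>a. \<forall>C \<in> lit_cone E x y ` E. a C \<in> E \<and> (\<forall>p \<in> E. lit_cone E x y p = C \<and> strictly_above E x y p \<noteq> {} \<longrightarrow>
    a C \<in> strictly_above E x y p \<and> (\<forall>h \<in> strictly_above E x y p. z (a C) \<le> z h))"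
proof (rule bchoice, rule ballI)
  fix C assume "C \<in> lit_cone E x y ` E"
  then obtain q where q: "q \<in> E" "lit_cone E x y q = C" by blast
  have same: "strictly_above E x y p = strictly_above E x y q" if "p \<in> E" "lit_cone E x y p = C" for p
    using same_lit_cone_strictly_above[of p E q x y] that q by simp
  show "\<exists>a. a \<in> E \<and> (\<forall>p \<in> E. lit_cone E x y p = C \<and> strictly_above E x y p \<noteq> {} \<longrightarrow>
    a \<in> strictly_above E x y p \<and> (\<forall>h \<in> strictly_above E x y p. z a \<le> z h))"
  proof (cases "strictly_above E x y q = {}")
    case True
    then show ?thesis using q same by blast
  next
    case False
    obtain a where a: "a \<in> strictly_above E x y q" "\<And>h. h \<in> strictly_above E x y q \<Longrightarrow> z a \<le> z h"
      by (rule obtain_arg_min[OF False, where z = z]) (rule that)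
    have "a \<in> E" using a by (simp add: strictly_above_def)
    then show ?thesis using a same by (intro exI[of _ a]) auto
  qed
qed

text \<open>All conditions are imposed per class or per pair of classes, which is what makes the bound independent of
the size of \<open>E\<close>.\<close>

lemma small_point_set:
  assumes c: "corners E x y e f"
  obtains S where "S \<subseteq> E" and "corners S x y e f" and "card S \<le> 3 * card (lit_cone E x y ` E) ^ 2"
    and "order_iso (inclusion_order (lit_closed E x y)) (inclusion_order (lit_closed S x y)) (\<lambda>T. T \<inter> S)"
proof -
  let ?cone = "lit_cone E x y" and ?A = "strictly_above E x y"
  let ?C = "?cone ` E"
  let ?k = "card ?C"
  have fin: "finite ?C" using finite_E by simp
  have ef: "e \<in> E" "f \<in> E" using c by (simp_all add: corners_def)
  have "\<exists>w. \<forall>CD \<in> ?C \<times> ?C. fst (w CD) \<in> E \<and> snd (w CD) \<in> E \<and>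
      ?cone (fst (w CD)) = fst CD \<and> ?cone (snd (w CD)) = snd CD \<and>
      ((\<exists>p q. lit E x y p q \<and> ?cone p = fst CD \<and> ?cone q = snd CD) \<longrightarrow> lit E x y (fst (w CD)) (snd (w CD)))"
  proof (rule bchoice, rule ballI)
    fix CD assume "CD \<in> ?C \<times> ?C"
    then obtain p q where pq: "p \<in> E" "q \<in> E" "?cone p = fst CD" "?cone q = snd CD" by auto
    show "\<exists>w. fst w \<in> E \<and> snd w \<in> E \<and> ?cone (fst w) = fst CD \<and> ?cone (snd w) = snd CD \<and>
      ((\<exists>p q. lit E x y p q \<and> ?cone p = fst CD \<and> ?cone q = snd CD) \<longrightarrow> lit E x y (fst w) (snd w))"
    proof (cases "\<exists>p q. lit E x y p q \<and> ?cone p = fst CD \<and> ?cone q = snd CD")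
      case True
      then obtain p' q' where pq': "lit E x y p' q'" "?cone p' = fst CD" "?cone q' = snd CD" by blast
      then show ?thesis using lit_in[OF pq'(1)] by (intro exI[of _ "(p', q')"]) simp
    next
      case False
      then show ?thesis using pq by (intro exI[of _ "(p, q)"]) (simp only: fst_conv snd_conv, blast)
    qed
  qed
  then obtain w where w': "\<forall>CD \<in> ?C \<times> ?C. fst (w CD) \<in> E \<and> snd (w CD) \<in> E \<and>
      ?cone (fst (w CD)) = fst CD \<and> ?cone (snd (w CD)) = snd CD \<and>
      ((\<exists>p q. lit E x y p q \<and> ?cone p = fst CD \<and> ?cone q = snd CD) \<longrightarrow> lit E x y (fst (w CD)) (snd (w CD)))" ..
  note w = bspec[OF w']
  obtain a where a: "\<forall>C \<in> ?C. a C \<in> E \<and> (\<forall>p \<in> E. ?cone p = C \<and> ?A p \<noteq> {} \<longrightarrow>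
      a C \<in> ?A p \<and> (\<forall>h \<in> ?A p. x (a C) \<le> x h))"
    using class_extremal_point[of x] ..
  obtain b where b: "\<forall>C \<in> ?C. b C \<in> E \<and> (\<forall>p \<in> E. ?cone p = C \<and> ?A p \<noteq> {} \<longrightarrow>
      b C \<in> ?A p \<and> (\<forall>h \<in> ?A p. y (b C) \<le> y h))"
    using class_extremal_point[of y] ..
  \<comment> \<open>For a pair of classes without any lighting between them, the witnesses are arbitrary members; with equal classes they provide a representative of each class.\<close>
  define S1 where "S1 = (fst \<circ> w) ` (?C \<times> ?C)"
  define S2 where "S2 = (snd \<circ> w) ` (?C \<times> ?C)"
  define S where "S = S1 \<union> S2 \<union> (a ` ?C \<union> b ` ?C)"
  have "S1 \<subseteq> E" "S2 \<subseteq> E" using w by (auto simp: S1_def S2_def)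
  then have S: "S \<subseteq> E" using a b unfolding S_def by blast
  have rep: "\<exists>s \<in> S. ?cone s = ?cone p" if p: "p \<in> E" for p
  proof -
    have "(?cone p, ?cone p) \<in> ?C \<times> ?C" using p by blast
    then have "fst (w (?cone p, ?cone p)) \<in> S1" "?cone (fst (w (?cone p, ?cone p))) = ?cone p"
      using w[of "(?cone p, ?cone p)"] by (auto simp: S1_def simp del: mem_Sigma_iff)
    then show ?thesis by (auto simp: S_def)
  qed
  have wit: "\<exists>s \<in> S. \<exists>t \<in> S. ?cone s = ?cone p \<and> ?cone t = ?cone q \<and> lit E x y s t"
    if l: "lit E x y p q" for p q
  proof -
    let ?CD = "(?cone p, ?cone q)"
    have CD: "?CD \<in> ?C \<times> ?C" using lit_in[OF l] by blast
    have "fst (w ?CD) \<in> S" "snd (w ?CD) \<in> S"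
      using CD by (auto simp: S_def S1_def S2_def simp del: mem_Sigma_iff)
    moreover have "?cone (fst (w ?CD)) = ?cone p" "?cone (snd (w ?CD)) = ?cone q"
      "lit E x y (fst (w ?CD)) (snd (w ?CD))" using w[OF CD] l by auto
    ultimately show ?thesis by blast
  qed
  have eS: "e \<in> S"
  proof -
    obtain s where s: "s \<in> S" "?cone s = ?cone e" using rep[OF ef(1)] by blast
    then show ?thesis using corner_lit_cone(1)[OF c, of s] S by blast
  qed
  have fS: "f \<in> S"
  proof -
    obtain s where s: "s \<in> S" "?cone s = ?cone f" using rep[OF ef(2)] by blast
    then show ?thesis using corner_lit_cone(2)[OF c, of s] S by blast
  qed
  have lit: "lit S x y p q \<longleftrightarrow> lit E x y p q" if pq: "p \<in> S" "q \<in> S" for p q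
  proof (rule lit_subset_iff[OF c S eS fS pq])
    have q: "q \<in> E" using pq S by blast
    assume ne: "?A q \<noteq> {}"
    have "a (?cone q) \<in> S" "b (?cone q) \<in> S" using q by (auto simp: S_def)
    moreover have "a (?cone q) \<in> ?A q \<and> (\<forall>h \<in> ?A q. x (a (?cone q)) \<le> x h)" using a q ne by blast
    moreover have "b (?cone q) \<in> ?A q \<and> (\<forall>h \<in> ?A q. y (b (?cone q)) \<le> y h)" using b q ne by blast
    ultimately show "\<exists>a \<in> S. a \<in> ?A q \<and> (\<forall>h \<in> ?A q. x a \<le> x h)"
      "\<exists>a \<in> S. a \<in> ?A q \<and> (\<forall>h \<in> ?A q. y a \<le> y h)" by blast+
  qed
  have "e \<noteq> f" using corners_left_less[OF c] by auto
  then have "?cone e \<noteq> ?cone f" using corner_lit_cone(2)[OF c ef(1)] by blast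
  then have "card {?cone e, ?cone f} = 2" by simp
  moreover have "card {?cone e, ?cone f} \<le> ?k" using ef by (intro card_mono fin) auto
  ultimately have k: "2 \<le> ?k" by simp
  have "card S1 \<le> card (?C \<times> ?C)" "card S2 \<le> card (?C \<times> ?C)"
    unfolding S1_def S2_def by (rule card_image_le[OF finite_cartesian_product[OF fin fin]])+
  then have "card S1 \<le> ?k ^ 2" "card S2 \<le> ?k ^ 2" by (simp_all add: card_cartesian_product power2_eq_square)
  moreover have "card (a ` ?C) \<le> ?k" "card (b ` ?C) \<le> ?k" by (rule card_image_le[OF fin])+
  moreover have "card S \<le> (card S1 + card S2) + (card (a ` ?C) + card (b ` ?C))"
    unfolding S_def by (rule order_trans[OF card_Un_le], rule add_mono; rule card_Un_le)
  moreover have "2 * ?k \<le> ?k ^ 2" using k by (simp add: power2_eq_square)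
  ultimately have "card S \<le> 3 * ?k ^ 2" by linarith
  moreover have "corners S x y e f" by (rule corners_subset[OF c S eS fS])
  moreover have "order_iso (inclusion_order (lit_closed E x y)) (inclusion_order (lit_closed S x y)) (\<lambda>T. T \<inter> S)"
    by (rule lit_closed_restrict_iso[OF S rep wit lit])
  ultimately show ?thesis using that S by blast
qed

lemma quadrant_lattice_on_nat:
  obtains L :: "nat gorder" and cl where "quadrant_lattice E x y L cl"
proof -
  have "finite (quadrants E x y)"
    using finite_E by (rule finite_subset[rotated, OF finite_Pow_iff[THEN iffD2]]) (auto simp: quadrants_def)
  then obtain cl where cl: "bij_betw cl {0..<card (quadrants E x y)} (quadrants E x y)"
    using ex_bij_betw_nat_finite by blast
  let ?L = "\<lparr>carrier = {0..<card (quadrants E x y)}, eq = (=), le = (\<lambda>a b. cl b \<subseteq> cl a)\<rparr> :: nat gorder"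
  have "quadrant_lattice E x y ?L cl"
    by unfold_locales (use cl in simp_all)
  then show ?thesis by (rule that)
qed

end

section \<open>Small representing lattices\<close>

theorem mainTheorem4:
  fixes D :: "'d gorder" and n :: nat
  assumes "finite_lattice D" and "distributive_lattice D"
    and "\<exists>K :: 'k gorder. slim_rectangular K \<and> lattice_isomorphic D (Con K)"
    and "n = card (join_irreducibles D)"
  shows "\<exists>L :: nat gorder. slim_rectangular L \<and> lattice_isomorphic (Con L) D \<and>
    lattice_length L \<le> 3 * n ^ 2 \<and> card (carrier L) \<le> 9 * n ^ 4"
proof -
  obtain K :: "'k gorder" where K: "slim_rectangular K" and iso: "lattice_isomorphic D (Con K)"
    using assms(3) by blast
  obtain u where "u \<in> join_irreducibles K" using K by (auto simp: slim_rectangular_def)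
  then have "u \<in> carrier K" by (simp add: join_irreducibles_def)
  moreover have "slim_semimodular K" using K by (simp add: slim_rectangular_def)
  ultimately obtain x y where
    "quadrant_lattice (meet_irreducibles K) x y K (\<lambda>a. {m \<in> meet_irreducibles K. a \<sqsubseteq>\<^bsub>K\<^esub> m})"
    using slim_semimodular_quadrant_lattice by metis
  then interpret K: quadrant_lattice "meet_irreducibles K" x y K "\<lambda>a. {m \<in> meet_irreducibles K. a \<sqsubseteq>\<^bsub>K\<^esub> m}" .
  let ?E = "meet_irreducibles K"
  obtain e f where "corners ?E x y e f" by (rule K.corners_if_rectangular[OF K])
  then obtain S where S: "S \<subseteq> ?E" and corners: "corners S x y e f"
    and small: "card S \<le> 3 * card (lit_cone ?E x y ` ?E) ^ 2"
    and thin: "order_iso (inclusion_order (lit_closed ?E x y)) (inclusion_order (lit_closed S x y)) (\<lambda>T. T \<inter> S)"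
    by (rule K.small_point_set)
  interpret S: planar_points S x y by (rule K.planar_points_subset[OF S])
  obtain L :: "nat gorder" and cl where "quadrant_lattice S x y L cl" by (rule S.quadrant_lattice_on_nat)
  then interpret L: quadrant_lattice S x y L cl .
  obtain g where g: "order_iso D (Con K) g" using iso by (rule order_iso_if_lattice_isomorphic)
  note D_K = order_iso_trans[OF g K.Con_order_iso]
  have "card (lit_cone ?E x y ` ?E) \<le> n"
    unfolding assms(4)
    by (rule card_principal_le_join_irreducibles[OF assms(1) D_K lit_closed_empty lit_closed_Un lit_cone_least])
  then have "card (lit_cone ?E x y ` ?E) ^ 2 \<le> n ^ 2" by (rule power_mono) simp
  then have S_le: "card S \<le> 3 * n ^ 2" using small by linarith
  have "slim_rectangular L" by (rule L.rectangular_if_corners[OF corners])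
  moreover have "lattice_isomorphic (Con L) D"
    using order_iso_trans[OF L.Con_order_iso order_iso_sym[OF order_iso_trans[OF D_K thin]]]
  proof (rule lattice_isomorphic_if_order_iso)
    show "eq (Con L) = (=)" by (simp add: Con_def)
    show "lattice D" using assms(1) by (simp add: finite_lattice_def)
  qed
  moreover have "lattice_length L \<le> 3 * n ^ 2" using L.length_le S_le by linarith
  moreover have "card (carrier L) \<le> 9 * n ^ 4"
  proof -
    have "card (carrier L) \<le> card S ^ 2" by (rule L.card_carrier_le[OF corners])
    also have "\<dots> \<le> (3 * n ^ 2) ^ 2" using S_le by (rule power_mono) simp
    finally show ?thesis by (simp add: power_mult_distrib flip: power_mult)
  qed
  ultimately show ?thesis by blast
qed

end
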